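(* Let $X$ be the Cantor space and let $\Gamma,\Lambda\le\mathrm{Homeo}(X)$ be ample groups acting minimally on $X$ and having isomorphic closures. Let $K,L$ be closed subsets of $X$ such that $K$ is $\Gamma$-sparse and $L$ is $\Lambda$-sparse. Assume that $h\colon K\to L$ is a homeomorphism. Then there exists $g\in\mathrm{Homeo}(X)$ such that $g\Gamma g^{-1}=\Lambda$ and $g_{|K}=h$.
   Context: $\mathrm{Homeo}(X)$ is the group of homeomorphisms of $X$, with its usual Polish topology (compact-open topology; equivalently, a neighborhood basis of the identity is given by the subgroups $\{g\colon g(A)=A\ \forall A\in\mathcal{A}\}$, where $\mathcal{A}$ ranges over finite clopen partitions of $X$). A subgroup $\Gamma\le\mathrm{Homeo}(X)$ is a full group if it contains every $g\in\mathrm{Homeo}(X)$ for which there is a finite $A\subset\Gamma$ such that for all $x\in X$ there is $\gamma\in A$ with $g(x)=\gamma(x)$. $\Gamma$ is ample if it is a countable, locally finite, full group such that $\{x\in X\colon\gamma(x)=x\}$ is clopen for every $\gamma\in\Gamma$. It acts minimally if all its orbits in $X$ are dense. Two ample groups $\Gamma,\Lambda$ have isomorphic closures if there exists $g\in\mathrm{Homeo}(X)$ such that $g\overline{\Gamma}g^{-1}=\overline{\Lambda}$ (closures in $\mathrm{Homeo}(X)$); equivalently, there exists $g\in\mathrm{Homeo}(X)$ such that for all clopen $U,V\subseteq X$: ($\exists\gamma\in\Gamma$, $\gamma(U)=V$) if and only if ($\exists\lambda\in\Lambda$, $\lambda(g(U))=g(V)$). A closed set $K\subseteq X$ is $\Gamma$-sparse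 if each $\Gamma$-orbit intersects $K$ in at most one point. *)

theory Defs
  imports "HOL-Analysis.Analysis" "HOL-Algebra.Generated_Groups"
begin

text \<open>The Cantor space is the whole of a type, carrying a topology
  homeomorphic to \<open>2\<^sup>\<nat>\<close>.\<close>

definition is_cantor_space :: "'a topology \<Rightarrow> bool" where
  "is_cantor_space X \<longleftrightarrow>
     X homeomorphic_space product_topology (\<lambda>_::nat. discrete_topology (UNIV :: bool set)) UNIV"

definition homeo_group :: "('a::topological_space \<Rightarrow> 'a) monoid" where
  "homeo_group = \<lparr>carrier = {g. \<exists>g'. homeomorphism UNIV UNIV g g'}, mult = (\<circ>), one = id\<rparr>"

abbreviation Homeo :: "('a::topological_space \<Rightarrow> 'a) set" where
  "Homeo \<equiv> carrier homeo_group"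

lemma group_homeo_group: "group (homeo_group :: ('a::topological_space \<Rightarrow> 'a) monoid)"
proof (rule groupI)
  fix f g :: "'a \<Rightarrow> 'a"
  assume "f \<in> Homeo" "g \<in> Homeo"
  then show "f \<otimes>\<^bsub>homeo_group\<^esub> g \<in> Homeo"
    by (auto simp: homeo_group_def intro: homeomorphism_compose)
next
  fix f :: "'a \<Rightarrow> 'a"
  assume "f \<in> Homeo"
  then obtain f' where f': "homeomorphism UNIV UNIV f f'"
    by (auto simp: homeo_group_def)
  then have "homeomorphism UNIV UNIV f' f"
    by (rule homeomorphism_symD)
  moreover have "f' \<circ> f = id"
    using f' by (auto simp: homeomorphism_def)
  ultimately show "\<exists>g\<in>Homeo. g \<otimes>\<^bsub>homeo_group\<^esub> f = \<one>\<^bsub>homeo_group\<^esub>"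
    by (auto simp: homeo_group_def)
next
  show "\<one>\<^bsub>homeo_group\<^esub> \<in> (Homeo :: ('a \<Rightarrow> 'a) set)"
    by (auto simp: homeo_group_def homeomorphism_def intro!: exI[of _ id])
qed (auto simp: homeo_group_def comp_assoc)

text \<open>The compact-open topology; the Cantor space being compact, it makes
  \<^term>\<open>Homeo\<close> a Polish group.\<close>

definition homeo_topology :: "('a::topological_space \<Rightarrow> 'a) topology" where
  "homeo_topology =
     topology_generated_by {{g \<in> Homeo. g ` C \<subseteq> U} | C U. compact C \<and> open U}"

lemma topspace_homeo_topology: "topspace homeo_topology = Homeo"
proof -
  have "Homeo \<in> {{g \<in> Homeo. g ` C \<subseteq> U} | C U. compact C \<and> open U}"
    by (rule CollectI, rule exI[of _ "{}"], rule exI[of _ UNIV]) auto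
  then show ?thesis
    unfolding homeo_topology_def topology_generated_by_topspace by blast
qed

definition full_group :: "('a::topological_space \<Rightarrow> 'a) set \<Rightarrow> bool" where
  "full_group \<Gamma> \<longleftrightarrow> subgroup \<Gamma> homeo_group \<and>
     (\<forall>g\<in>Homeo. (\<exists>A. finite A \<and> A \<subseteq> \<Gamma> \<and> (\<forall>x. \<exists>\<gamma>\<in>A. g x = \<gamma> x)) \<longrightarrow> g \<in> \<Gamma>)"

definition locally_finite_group :: "('a::topological_space \<Rightarrow> 'a) set \<Rightarrow> bool" where
  "locally_finite_group \<Gamma> \<longleftrightarrow> (\<forall>A. finite A \<and> A \<subseteq> \<Gamma> \<longrightarrow> finite (generate homeo_group A))"

definition ample :: "('a::topological_space \<Rightarrow> 'a) set \<Rightarrow> bool" where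
  "ample \<Gamma> \<longleftrightarrow> countable \<Gamma> \<and> locally_finite_group \<Gamma> \<and> full_group \<Gamma> \<and>
     (\<forall>\<gamma>\<in>\<Gamma>. closed {x. \<gamma> x = x} \<and> open {x. \<gamma> x = x})"

definition orb :: "('a \<Rightarrow> 'a) set \<Rightarrow> 'a \<Rightarrow> 'a set" where
  "orb \<Gamma> x = {\<gamma> x | \<gamma>. \<gamma> \<in> \<Gamma>}"

definition acts_minimally :: "('a::topological_space \<Rightarrow> 'a) set \<Rightarrow> bool" where
  "acts_minimally \<Gamma> \<longleftrightarrow> (\<forall>x. closure (orb \<Gamma> x) = UNIV)"

definition conj_by :: "('a::topological_space \<Rightarrow> 'a) \<Rightarrow> ('a \<Rightarrow> 'a) set \<Rightarrow> ('a \<Rightarrow> 'a) set" where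
  "conj_by g \<Gamma> =
     (\<lambda>\<gamma>. g \<otimes>\<^bsub>homeo_group\<^esub> \<gamma> \<otimes>\<^bsub>homeo_group\<^esub> inv\<^bsub>homeo_group\<^esub> g) ` \<Gamma>"

definition isomorphic_closures ::
    "('a::topological_space \<Rightarrow> 'a) set \<Rightarrow> ('a \<Rightarrow> 'a) set \<Rightarrow> bool" where
  "isomorphic_closures \<Gamma> \<Lambda> \<longleftrightarrow>
     (\<exists>g\<in>Homeo. conj_by g (homeo_topology closure_of \<Gamma>) = homeo_topology closure_of \<Lambda>)"

definition orbit_sparse :: "('a::topological_space \<Rightarrow> 'a) set \<Rightarrow> 'a set \<Rightarrow> bool" where
  "orbit_sparse \<Gamma> K \<longleftrightarrow> closed K \<and> (\<forall>x. \<forall>y\<in>orb \<Gamma> x \<inter> K. \<forall>z\<in>orb \<Gamma> x \<inter> K. y = z)"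

end

theory Submission
  imports Defs
begin

text \<open>
  Back and forth. A stage consists of a homeomorphism \<open>g\<close>, a finite subgroup \<open>\<Delta>\<close> of \<open>\<Gamma>\<close> with
  \<open>g \<Delta> g\<inverse> \<subseteq> \<Lambda>\<close>, and a finite \<open>\<Delta>\<close>-invariant family \<open>F\<close> of clopen sets such that
  \<open>h(U \<inter> K) = g(U) \<inter> L\<close> for all \<open>U \<in> F\<close>. Two corrections enlarge a stage.
  By sparseness, points of \<open>L\<close> lying in the wrong piece can be pushed, by involutions in \<open>\<Lambda>\<close> supported
  in small clopen sets, to where \<open>h\<close> wants them; done on a fundamental domain and extended equivariantly,
  this commutes with \<open>\<Delta>\<close>. A larger group \<open>\<Delta>'\<close> is then conjugated into \<open>\<Lambda>\<close> by composing, piece by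
  piece, elements of \<open>\<Gamma>\<close> and \<open>\<Lambda>\<close> with the same effect on a clopen set; those exist because
  the closures agree. Alternating the roles of \<open>\<Gamma>\<close> and \<open>\<Lambda>\<close>, the stages converge.
\<close>

section \<open>Clopen sets and homeomorphisms\<close>

text \<open>The obstacle is stabilizers: the limit must carry the stabilizer of \<open>x\<close> in
  \<open>\<Gamma>\<close> to that of \<open>h x\<close> in \<open>\<Lambda>\<close>, while
  \<open>h\<close> is prescribed without regard to the groups. If every element of
  \<open>\<Delta>\<close> preserving an atom of \<open>F\<close> fixes it pointwise, stabilizers are
  constant on atoms, so putting \<open>h x\<close> into the right piece already gives it the right
  stabilizer. Clopenness of fixed-point sets is what makes such families exist. The matching of
  \<open>h\<close> is corrected before the larger group is conjugated: the second correction
  preserves every atom of the refined family, so it cannot spoil the first. Only the images of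
  members of \<open>F\<close> and the conjugates of members of \<open>\<Delta>\<close> are frozen.
  Since \<open>F\<close> eventually receives each clopen set and its preimage, both the maps and
  their inverses converge. The closures enter only through the relation "some group element maps
  \<open>U\<close> onto \<open>V\<close>" on clopen sets. The current \<open>g\<close> must respect
  it at every stage, so it is part of the invariant.\<close>

definition clopen :: "'a::topological_space set \<Rightarrow> bool" where
  "clopen U \<longleftrightarrow> closed U \<and> open U"

lemma clopen_basic [intro]:
  "clopen {}" "clopen UNIV"
  "clopen U \<Longrightarrow> clopen (- U)"
  "clopen U \<Longrightarrow> clopen V \<Longrightarrow> clopen (U \<inter> V)"
  "clopen U \<Longrightarrow> clopen V \<Longrightarrow> clopen (U \<union> V)"
  "clopen U \<Longrightarrow> clopen V \<Longrightarrow> clopen (U - V)"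
  by (auto simp: clopen_def)

lemma clopen_UN: "finite I \<Longrightarrow> (\<And>i. i \<in> I \<Longrightarrow> clopen (U i)) \<Longrightarrow> clopen (\<Union>i\<in>I. U i)"
  by (auto simp: clopen_def)

lemma clopen_INT: "finite I \<Longrightarrow> (\<And>i. i \<in> I \<Longrightarrow> clopen (U i)) \<Longrightarrow> clopen (\<Inter>i\<in>I. U i)"
  by (auto simp: clopen_def intro!: closed_INT open_INT)

text \<open>The topology is given only up to homeomorphism, so its properties are read off once in
  coordinates: \<open>\<phi> x k\<close> is the k-th bit of \<open>x\<close>, and the fourth
  property says that cylinders form a base.\<close>

lemma cantor_embedding:
  assumes "is_cantor_space (euclidean :: 'a::topological_space topology)"
  obtains \<phi> :: "'a::topological_space \<Rightarrow> nat \<Rightarrow> bool" and \<psi>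
  where "\<And>x. \<psi> (\<phi> x) = x" "\<And>p. \<phi> (\<psi> p) = p"
    "\<And>k. clopen {x. \<phi> x k}"
    "\<And>U x. open U \<Longrightarrow> x \<in> U \<Longrightarrow> \<exists>n. \<forall>y. (\<forall>k<n. \<phi> y k = \<phi> x k) \<longrightarrow> y \<in> U"
    "compact (UNIV :: 'a::topological_space set)"
proof -
  let ?T = "product_topology (\<lambda>_::nat. discrete_topology (UNIV :: bool set)) UNIV"
  obtain \<phi> \<psi> where h: "homeomorphic_maps (euclidean :: 'a topology) ?T \<phi> \<psi>"
    using assms unfolding is_cantor_space_def homeomorphic_space_def by blast
  have inv1: "\<psi> (\<phi> x) = x" for x using h by (auto simp: homeomorphic_maps_def)
  have inv2: "\<phi> (\<psi> p) = p" for p using h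
    by (auto simp: homeomorphic_maps_def PiE_def extensional_def)
  have c\<phi>: "continuous_map euclidean ?T \<phi>" and c\<psi>: "continuous_map ?T euclidean \<psi>"
    using h by (auto simp: homeomorphic_maps_def)
  have cpt: "compact_space ?T"
    by (simp add: compact_space_product_topology compact_space_discrete_topology)
  have "compactin (euclidean :: 'a topology) (\<psi> ` topspace ?T)"
    using c\<psi> cpt by (metis compact_space_def image_compactin)
  moreover have "\<psi> ` topspace ?T = UNIV"
    using inv1 by (auto simp: PiE_def extensional_def) (metis rangeI)
  ultimately have cU: "compact (UNIV :: 'a set)" by simp
  have c_k: "continuous_map euclidean (discrete_topology (UNIV::bool set)) (\<lambda>x. \<phi> x k)" for k
    using c\<phi> by (simp add: continuous_map_componentwise_UNIV)
  have op: "open {x. \<phi> x k \<in> B}" for k B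
  proof -
    have "openin euclidean {x \<in> topspace euclidean. \<phi> x k \<in> B}"
      using c_k[of k] by (rule openin_continuous_map_preimage) simp
    then show ?thesis by simp
  qed
  have clo: "clopen {x. \<phi> x k}" for k
    using op[of k "{True}"] op[of k "{False}"]
    by (simp add: clopen_def closed_def Collect_neg_eq)
  have nb: "\<exists>n. \<forall>y. (\<forall>k<n. \<phi> y k = \<phi> x k) \<longrightarrow> y \<in> U" if "open U" "x \<in> U" for U x
  proof -
    have "openin ?T {p \<in> topspace ?T. \<psi> p \<in> U}"
      using c\<psi> by (rule openin_continuous_map_preimage) (use that in simp)
    moreover have "\<phi> x \<in> {p \<in> topspace ?T. \<psi> p \<in> U}" using that inv1 by simp
    ultimately obtain V where fin: "finite {i \<in> UNIV. V i \<noteq> topspace (discrete_topology (UNIV :: bool set))}"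
      and xV: "\<phi> x \<in> Pi\<^sub>E UNIV V" and sub: "Pi\<^sub>E UNIV V \<subseteq> {p \<in> topspace ?T. \<psi> p \<in> U}"
      unfolding openin_product_topology_alt by blast
    then obtain n where n: "\<And>i. V i \<noteq> UNIV \<Longrightarrow> i < n"
      by (auto dest: finite_nat_bounded) (metis (mono_tags, lifting) finite_nat_set_iff_bounded mem_Collect_eq)
    have "y \<in> U" if "\<forall>k<n. \<phi> y k = \<phi> x k" for y
    proof -
      have "\<phi> y k \<in> V k" for k
        using n[of k] that xV by (cases "k < n") (auto simp: PiE_def Pi_def)
      then have "\<phi> y \<in> Pi\<^sub>E UNIV V" by (auto simp: PiE_def extensional_def)
      then show ?thesis using sub inv1 by auto
    qed
    then show ?thesis by blast
  qed
  show thesis by (rule that[OF inv1 inv2 clo nb cU])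
qed

lemma clopen_base:
  fixes x :: "'a::topological_space"
  assumes "is_cantor_space (euclidean :: 'a topology)" "open U" "x \<in> U"
  shows "\<exists>W. clopen W \<and> x \<in> W \<and> W \<subseteq> U"
proof -
  obtain \<phi> :: "'a \<Rightarrow> nat \<Rightarrow> bool" and \<psi> where
    *: "\<And>x. \<psi> (\<phi> x) = x" "\<And>p. \<phi> (\<psi> p) = p" "\<And>k. clopen {x. \<phi> x k}"
    "\<And>U x. open U \<Longrightarrow> x \<in> U \<Longrightarrow> \<exists>n. \<forall>y. (\<forall>k<n. \<phi> y k = \<phi> x k) \<longrightarrow> y \<in> U" "compact (UNIV :: 'a set)"
    by (rule cantor_embedding[OF assms(1)]) blast
  obtain n where n: "\<forall>y. (\<forall>k<n. \<phi> y k = \<phi> x k) \<longrightarrow> y \<in> U" using *(4) assms by blast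
  let ?W = "\<Inter>k\<in>{..<n}. if \<phi> x k then {y. \<phi> y k} else - {y. \<phi> y k}"
  have "clopen ?W" using *(3) by (intro clopen_INT) auto
  moreover have "x \<in> ?W" by auto
  moreover have "?W \<subseteq> U" using n by (auto split: if_splits)
  ultimately show ?thesis by blast
qed

lemma cantor_compact:
  fixes C :: "'a::topological_space set"
  assumes "is_cantor_space (euclidean :: 'a topology)" "closed C"
  shows "compact C"
  using cantor_embedding[OF assms(1)] assms(2) closed_Int_compact by (metis inf_top_right)

lemma clopen_separation:
  fixes A B :: "'a::topological_space set"
  assumes "is_cantor_space (euclidean :: 'a topology)" "closed A" "closed B" "A \<inter> B = {}"
  shows "\<exists>W. clopen W \<and> A \<subseteq> W \<and> W \<inter> B = {}"
proof -
  have "\<exists>W. clopen W \<and> x \<in> W \<and> W \<subseteq> - B" if "x \<in> A" for x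
    using clopen_base[OF assms(1), of "- B" x] assms that by auto
  then obtain W where W: "\<And>x. x \<in> A \<Longrightarrow> clopen (W x) \<and> x \<in> W x \<and> W x \<subseteq> - B" by metis
  obtain T where T: "T \<subseteq> A" "finite T" "A \<subseteq> (\<Union>x\<in>T. W x)"
    using compactE_image[OF cantor_compact[OF assms(1,2)], of A W] W
    by (metis UN_I clopen_def subsetI)
  show ?thesis
    by (rule exI[of _ "\<Union>x\<in>T. W x"]) (use T W in \<open>auto intro!: clopen_UN\<close>)
qed

text \<open>One implication suffices because complements of clopen sets are clopen. Identities
  between limit maps are proved by this test.\<close>

lemma clopen_points_eq:
  fixes x y :: "'a::topological_space"
  assumes "is_cantor_space (euclidean :: 'a topology)" "\<And>U. clopen U \<Longrightarrow> x \<in> U \<Longrightarrow> y \<in> U"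
  shows "x = y"
proof -
  obtain \<phi> :: "'a \<Rightarrow> nat \<Rightarrow> bool" and \<psi> where
    *: "\<And>x. \<psi> (\<phi> x) = x" "\<And>p. \<phi> (\<psi> p) = p" "\<And>k. clopen {x. \<phi> x k}"
    "\<And>U x. open U \<Longrightarrow> x \<in> U \<Longrightarrow> \<exists>n. \<forall>y. (\<forall>k<n. \<phi> y k = \<phi> x k) \<longrightarrow> y \<in> U" "compact (UNIV :: 'a set)"
    by (rule cantor_embedding[OF assms(1)]) blast
  have "\<phi> x k = \<phi> y k" for k
    using assms(2)[OF *(3)[of k]] assms(2)[of "- {z. \<phi> z k}"] *(3)[of k] by (auto intro: clopen_basic)
  then have "\<phi> x = \<phi> y" by blast
  then show ?thesis using *(1) by metis
qed

text \<open>By compactness a clopen set is a finite union of cylinders, and cylinders are indexed by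
  bit lists.\<close>

lemma countable_clopen:
  assumes "is_cantor_space (euclidean :: 'a::topological_space topology)"
  shows "countable {U :: 'a::topological_space set. clopen U}"
proof -
  obtain \<phi> :: "'a \<Rightarrow> nat \<Rightarrow> bool" and \<psi> where
    *: "\<And>x. \<psi> (\<phi> x) = x" "\<And>p. \<phi> (\<psi> p) = p" "\<And>k. clopen {x. \<phi> x k}"
    "\<And>U x. open U \<Longrightarrow> x \<in> U \<Longrightarrow> \<exists>n. \<forall>y. (\<forall>k<n. \<phi> y k = \<phi> x k) \<longrightarrow> y \<in> U" "compact (UNIV :: 'a set)"
    by (rule cantor_embedding[OF assms(1)]) blast
  define cyl where "cyl = (\<lambda>p::bool list. {y. \<forall>k<length p. \<phi> y k = p ! k})"
  have cyl: "clopen (cyl p)" for p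
  proof -
    have "cyl p = (\<Inter>k\<in>{..<length p}. if p ! k then {y. \<phi> y k} else - {y. \<phi> y k})"
      unfolding cyl_def by (auto split: if_splits)
    also have "clopen \<dots>" using *(3) by (intro clopen_INT) auto
    finally show ?thesis .
  qed
  have "{U :: 'a set. clopen U} \<subseteq> (\<lambda>S. \<Union> (cyl ` S)) ` {S. finite S}"
  proof
    fix U :: "'a set" assume "U \<in> {U. clopen U}"
    then have U: "clopen U" by simp
    have "\<exists>p. x \<in> cyl p \<and> cyl p \<subseteq> U" if x: "x \<in> U" for x
    proof -
      obtain n where n: "\<forall>y. (\<forall>k<n. \<phi> y k = \<phi> x k) \<longrightarrow> y \<in> U"
        using *(4) U x unfolding clopen_def by blast
      show ?thesis by (rule exI[of _ "map (\<phi> x) [0..<n]"]) (use n in \<open>auto simp: cyl_def\<close>)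
    qed
    then obtain p where p: "\<And>x. x \<in> U \<Longrightarrow> x \<in> cyl (p x) \<and> cyl (p x) \<subseteq> U" by metis
    have "compact U" using U assms cantor_compact unfolding clopen_def by blast
    then obtain T where T: "T \<subseteq> U" "finite T" "U \<subseteq> (\<Union>x\<in>T. cyl (p x))"
      using compactE_image[of U U "\<lambda>x. cyl (p x)"] p cyl
      by (metis UN_I clopen_def subsetI)
    show "U \<in> (\<lambda>S. \<Union> (cyl ` S)) ` {S. finite S}"
    proof (rule image_eqI)
      show "U = \<Union> (cyl ` (p ` T))" using T p by auto
      show "p ` T \<in> {S. finite S}" using T by simp
    qed
  qed
  moreover have "countable {S :: bool list set. finite S}"
    using countable_Collect_finite by blast
  ultimately show ?thesis by (meson countable_image countable_subset)
qed

text \<open>The plain notation \<open>inv\<close> is taken by HOL-Algebra.\<close>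

abbreviation finv :: "('a \<Rightarrow> 'b) \<Rightarrow> 'b \<Rightarrow> 'a" where
  "finv \<equiv> inv_into UNIV"

section \<open>Homeomorphisms and piecewise gluing\<close>

lemma Homeo_iff:
  "f \<in> Homeo \<longleftrightarrow> bij f \<and> continuous_on UNIV f \<and> continuous_on UNIV (finv f)"
proof
  assume "f \<in> Homeo"
  then obtain g where g: "homeomorphism UNIV UNIV f g" by (auto simp: homeo_group_def)
  then have *: "f \<circ> g = id" "g \<circ> f = id" by (auto simp: homeomorphism_def)
  then have "finv f = g" "bij f" using inv_unique_comp o_bij by blast+
  then show "bij f \<and> continuous_on UNIV f \<and> continuous_on UNIV (finv f)"
    using g by (auto simp: homeomorphism_def)
next
  assume *: "bij f \<and> continuous_on UNIV f \<and> continuous_on UNIV (finv f)"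
  then have "homeomorphism UNIV UNIV f (finv f)"
    by (auto simp: homeomorphism_def bij_is_inj bij_is_surj surj_f_inv_f bij_imp_bij_inv)
  then show "f \<in> Homeo" by (auto simp: homeo_group_def)
qed

lemma Homeo_bij: "f \<in> Homeo \<Longrightarrow> bij f"
  by (simp add: Homeo_iff)

lemma Homeo_inv_f [simp]: "f \<in> Homeo \<Longrightarrow> finv f (f x) = x"
  by (simp add: Homeo_iff bij_is_inj)

lemma Homeo_f_inv [simp]: "f \<in> Homeo \<Longrightarrow> f (finv f x) = x"
  by (simp add: Homeo_iff bij_is_surj surj_f_inv_f)

lemma Homeo_eq_iff [simp]: "f \<in> Homeo \<Longrightarrow> f x = f y \<longleftrightarrow> x = y"
  by (metis Homeo_inv_f)

lemma Homeo_mem_image: "f \<in> Homeo \<Longrightarrow> x \<in> f ` U \<longleftrightarrow> finv f x \<in> U"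
  by (metis Homeo_f_inv Homeo_inv_f image_iff)

lemma Homeo_mem_image_f [simp]: "f \<in> Homeo \<Longrightarrow> f x \<in> f ` U \<longleftrightarrow> x \<in> U"
  by (auto)

lemma Homeo_id: "id \<in> Homeo"
  by (simp add: Homeo_iff)

lemma Homeo_inv: "f \<in> Homeo \<Longrightarrow> finv f \<in> Homeo"
  by (simp add: Homeo_iff bij_imp_bij_inv inv_inv_eq)

lemma Homeo_comp: "f \<in> Homeo \<Longrightarrow> g \<in> Homeo \<Longrightarrow> f \<circ> g \<in> Homeo"
  by (auto simp: homeo_group_def intro: homeomorphism_compose)

lemma Homeo_inv_inv [simp]: "f \<in> Homeo \<Longrightarrow> finv (finv f) = f"
  by (simp add: Homeo_iff inv_inv_eq)

lemma Homeo_inv_comp: "f \<in> Homeo \<Longrightarrow> g \<in> Homeo \<Longrightarrow> finv (f \<circ> g) = finv g \<circ> finv f"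
  by (simp add: Homeo_bij o_inv_distrib)

lemma Homeo_open_vimage: "f \<in> Homeo \<Longrightarrow> open U \<Longrightarrow> open (f -` U)"
  by (simp add: Homeo_iff open_vimage)

lemma Homeo_closed_vimage: "f \<in> Homeo \<Longrightarrow> closed U \<Longrightarrow> closed (f -` U)"
  by (simp add: Homeo_iff closed_vimage)

lemma Homeo_image_vimage: "f \<in> Homeo \<Longrightarrow> f ` U = finv f -` U"
  by (auto simp: Homeo_mem_image)

lemma Homeo_open: "f \<in> Homeo \<Longrightarrow> open U \<Longrightarrow> open (f ` U)"
  by (simp add: Homeo_image_vimage Homeo_inv Homeo_open_vimage)

lemma Homeo_closed: "f \<in> Homeo \<Longrightarrow> closed U \<Longrightarrow> closed (f ` U)"
  by (simp add: Homeo_image_vimage Homeo_inv Homeo_closed_vimage)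

lemma Homeo_clopen: "f \<in> Homeo \<Longrightarrow> clopen U \<Longrightarrow> clopen (f ` U)"
  by (simp add: clopen_def Homeo_open Homeo_closed)

lemma Homeo_clopen_vimage: "f \<in> Homeo \<Longrightarrow> clopen U \<Longrightarrow> clopen (f -` U)"
  by (simp add: clopen_def Homeo_open_vimage Homeo_closed_vimage)

text \<open>The inverse is continuous because \<open>f\<close> is open: it maps \<open>B\<close>
  onto the union of the open sets \<open>\<gamma> i (W i \<inter> B)\<close>. The pieces may
  overlap; bijectivity has to come from elsewhere.\<close>

lemma Homeo_glue:
  fixes f :: "'a::topological_space \<Rightarrow> 'a"
  assumes "bij f" and cover: "\<And>x. \<exists>i\<in>I. x \<in> W i"
    and W: "\<And>i. i \<in> I \<Longrightarrow> open (W i)" "\<And>i. i \<in> I \<Longrightarrow> \<gamma> i \<in> Homeo"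
    and f: "\<And>i x. i \<in> I \<Longrightarrow> x \<in> W i \<Longrightarrow> f x = \<gamma> i x"
  shows "f \<in> Homeo"
proof -
  have "continuous_on UNIV f"
    unfolding continuous_on_open_vimage[OF open_UNIV]
  proof (intro allI impI)
    fix B :: "'a set" assume B: "open B"
    have "f -` B \<inter> UNIV = (\<Union>i\<in>I. W i \<inter> \<gamma> i -` B)"
      using f cover by auto (metis f)+
    also have "open \<dots>" using W B by (auto intro!: open_Int Homeo_open_vimage)
    finally show "open (f -` B \<inter> UNIV)" .
  qed
  moreover have "continuous_on UNIV (finv f)"
    unfolding continuous_on_open_vimage[OF open_UNIV]
  proof (intro allI impI)
    fix B :: "'a set" assume B: "open B"
    have "finv f -` B \<inter> UNIV = f ` B" using \<open>bij f\<close> by (simp add: bij_vimage_eq_inv_image bij_imp_bij_inv inv_inv_eq)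
    also have "\<dots> = (\<Union>i\<in>I. \<gamma> i ` (W i \<inter> B))"
    proof
      show "f ` B \<subseteq> (\<Union>i\<in>I. \<gamma> i ` (W i \<inter> B))"
      proof
        fix y assume "y \<in> f ` B"
        then obtain x where x: "x \<in> B" "y = f x" by auto
        then obtain i where "i \<in> I" "x \<in> W i" using cover by blast
        then show "y \<in> (\<Union>i\<in>I. \<gamma> i ` (W i \<inter> B))" using x f by auto
      qed
      show "(\<Union>i\<in>I. \<gamma> i ` (W i \<inter> B)) \<subseteq> f ` B" using f by (auto intro!: image_eqI)
    qed
    also have "open \<dots>" using W B by (auto intro!: open_Int Homeo_open)
    finally show "open (finv f -` B \<inter> UNIV)" .
  qed
  ultimately show ?thesis using \<open>bij f\<close> by (simp add: Homeo_iff)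
qed

section \<open>Subgroups, full groups and conjugates as sets of functions\<close>

lemma inv_homeo_group: "f \<in> Homeo \<Longrightarrow> inv\<^bsub>homeo_group\<^esub> f = finv f"
  by (rule group.inv_equality[OF group_homeo_group])
     (auto simp: Homeo_inv, simp add: homeo_group_def fun_eq_iff Homeo_iff bij_is_inj)

lemma subgroup_homeo_iff:
  "subgroup G homeo_group \<longleftrightarrow>
     G \<subseteq> Homeo \<and> id \<in> G \<and> (\<forall>f\<in>G. \<forall>g\<in>G. f \<circ> g \<in> G) \<and> (\<forall>f\<in>G. finv f \<in> G)"
proof
  assume G: "subgroup G homeo_group"
  then have "G \<subseteq> Homeo" by (rule subgroup.subset)
  moreover have "id \<in> G" "\<forall>f\<in>G. \<forall>g\<in>G. f \<circ> g \<in> G"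
    using subgroup.one_closed[OF G] subgroup.m_closed[OF G] by (auto simp: homeo_group_def)
  moreover have "\<forall>f\<in>G. finv f \<in> G"
    using subgroup.m_inv_closed[OF G] inv_homeo_group \<open>G \<subseteq> Homeo\<close> by (metis subsetD)
  ultimately show "G \<subseteq> Homeo \<and> id \<in> G \<and> (\<forall>f\<in>G. \<forall>g\<in>G. f \<circ> g \<in> G) \<and> (\<forall>f\<in>G. finv f \<in> G)"
    by blast
next
  assume G: "G \<subseteq> Homeo \<and> id \<in> G \<and> (\<forall>f\<in>G. \<forall>g\<in>G. f \<circ> g \<in> G) \<and> (\<forall>f\<in>G. finv f \<in> G)"
  show "subgroup G homeo_group"
  proof (rule subgroup.intro)
    show "inv\<^bsub>homeo_group\<^esub> f \<in> G" if "f \<in> G" for f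
      using G that inv_homeo_group by (metis subsetD)
  qed (use G in \<open>auto simp: homeo_group_def\<close>)
qed

lemma subgroup_homeoD:
  assumes "subgroup G homeo_group"
  shows "f \<in> G \<Longrightarrow> f \<in> Homeo" "id \<in> G" "f \<in> G \<Longrightarrow> g \<in> G \<Longrightarrow> f \<circ> g \<in> G" "f \<in> G \<Longrightarrow> finv f \<in> G"
  using assms by (auto simp: subgroup_homeo_iff)

lemma full_subgroup: "full_group G \<Longrightarrow> subgroup G homeo_group"
  by (simp add: full_group_def)

lemma fullD:
  "full_group G \<Longrightarrow> g \<in> Homeo \<Longrightarrow> finite A \<Longrightarrow> A \<subseteq> G \<Longrightarrow> (\<And>x. \<exists>\<gamma>\<in>A. g x = \<gamma> x) \<Longrightarrow> g \<in> G"
  unfolding full_group_def by blast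

lemma conj_by_eq: "g \<in> Homeo \<Longrightarrow> conj_by g G = (\<lambda>\<gamma>. g \<circ> \<gamma> \<circ> finv g) ` G"
  by (simp add: conj_by_def inv_homeo_group) (simp add: homeo_group_def)

lemma full_glue:
  assumes "full_group G" "bij f" "finite I" "\<And>x. \<exists>i\<in>I. x \<in> W i"
    and "\<And>i. i \<in> I \<Longrightarrow> open (W i)" "\<And>i. i \<in> I \<Longrightarrow> \<gamma> i \<in> G"
    and "\<And>i x. i \<in> I \<Longrightarrow> x \<in> W i \<Longrightarrow> f x = \<gamma> i x"
  shows "f \<in> G"
proof (rule fullD[OF assms(1), of f "\<gamma> ` I"])
  show "f \<in> Homeo"
    using assms(4,5,7) subgroup_homeoD(1)[OF full_subgroup[OF assms(1)] assms(6)]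
    by (intro Homeo_glue[OF assms(2), of I W \<gamma>]) auto
qed (use assms in \<open>auto, metis\<close>)

lemma orb_mem: "\<gamma> \<in> G \<Longrightarrow> \<gamma> x \<in> orb G x"
  by (auto simp: orb_def)

section \<open>Moving sparse sets\<close>

text \<open>Three clopen pieces with \<open>\<gamma>\<close>, its inverse and the identity on them,
  so fullness applies; being an involution, the map is bijective.\<close>

lemma full_swap:
  assumes G: "full_group G" and "\<gamma> \<in> G" and W: "clopen W" and disj: "W \<inter> \<gamma> ` W = {}"
  shows "(\<lambda>x. if x \<in> W then \<gamma> x else if x \<in> \<gamma> ` W then finv \<gamma> x else x) \<in> G" (is "?\<sigma> \<in> G")
proof -
  note S = subgroup_homeoD[OF full_subgroup[OF G]]
  have [simp]: "\<gamma> \<in> Homeo" using S \<open>\<gamma> \<in> G\<close> by blast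
  have inv: "?\<sigma> (?\<sigma> x) = x" for x using disj by (auto simp: Homeo_mem_image)
  have bij: "bij ?\<sigma>" by (rule involuntory_imp_bij) (rule inv)
  have cl: "clopen (\<gamma> ` W)" using W by (simp add: Homeo_clopen)
  let ?W = "\<lambda>i. if i = 0 then W else if i = (1::nat) then \<gamma> ` W else - (W \<union> \<gamma> ` W)"
  let ?\<gamma> = "\<lambda>i. if i = 0 then \<gamma> else if i = (1::nat) then finv \<gamma> else id"
  show ?thesis
  proof (rule full_glue[OF G bij, of "{0, 1, 2}" ?W ?\<gamma>])
    show "\<exists>i\<in>{0, 1, 2}. x \<in> ?W i" for x by auto
    show "open (?W i)" for i using W cl by (auto simp: clopen_def intro!: open_Compl closed_Un)
    show "?\<gamma> i \<in> G" for i using S \<open>\<gamma> \<in> G\<close> by auto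
    show "?\<sigma> x = ?\<gamma> i x" if "i \<in> {0, 1, 2}" "x \<in> ?W i" for i x
      using that disj by (auto split: if_splits)
  qed simp
qed

section \<open>Orbit-sparse sets\<close>

lemma orbit_sparseD:
  assumes "orbit_sparse G L" "subgroup G homeo_group" "x \<in> L" "y \<in> L" "\<gamma> \<in> G" "\<gamma> x = y"
  shows "x = y"
proof -
  have "x \<in> orb G x" using subgroup_homeoD(2)[OF assms(2)] orb_mem[of id G x] by simp
  moreover have "y \<in> orb G x" using orb_mem[OF assms(5), of x] assms(6) by simp
  ultimately have "x \<in> orb G x \<inter> L" "y \<in> orb G x \<inter> L" using assms by auto
  then show ?thesis using assms(1) unfolding orbit_sparse_def by (metis (no_types))
qed

lemma orbit_sparseI:
  assumes "subgroup G homeo_group" "closed L"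
    and "\<And>x y \<gamma>. x \<in> L \<Longrightarrow> y \<in> L \<Longrightarrow> \<gamma> \<in> G \<Longrightarrow> \<gamma> x = y \<Longrightarrow> x = y"
  shows "orbit_sparse G L"
  unfolding orbit_sparse_def
proof (intro conjI allI ballI)
  note S = subgroup_homeoD[OF assms(1)]
  fix x y z assume y: "y \<in> orb G x \<inter> L" and z: "z \<in> orb G x \<inter> L"
  then obtain a b where ab: "a \<in> G" "b \<in> G" "y = a x" "z = b x" by (auto simp: orb_def)
  have "(b \<circ> finv a) y = z" "b \<circ> finv a \<in> G" using ab S by auto
  then show "y = z" using assms(3) y z by blast
qed (rule assms)

lemma orbit_sparse_closed: "orbit_sparse G L \<Longrightarrow> closed L"
  by (simp add: orbit_sparse_def)

text \<open>Moves are made one after another, so each one has to respect the image of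
  \<open>L\<close> under the earlier ones rather than \<open>L\<close>.\<close>

lemma orbit_sparse_image:
  assumes G: "subgroup G homeo_group" and "\<sigma> \<in> G" and L: "orbit_sparse G L"
  shows "orbit_sparse G (\<sigma> ` L)"
proof (rule orbit_sparseI[OF G])
  note S = subgroup_homeoD[OF G]
  show "closed (\<sigma> ` L)" using S(1)[OF \<open>\<sigma> \<in> G\<close>] orbit_sparse_closed[OF L] Homeo_closed by blast
  fix x y \<gamma> assume *: "x \<in> \<sigma> ` L" "y \<in> \<sigma> ` L" "\<gamma> \<in> G" "\<gamma> x = y"
  then obtain u v where uv: "u \<in> L" "v \<in> L" "x = \<sigma> u" "y = \<sigma> v" by blast
  have "(finv \<sigma> \<circ> \<gamma> \<circ> \<sigma>) u = v" using uv * S(1)[OF \<open>\<sigma> \<in> G\<close>] by auto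
  moreover have "finv \<sigma> \<circ> \<gamma> \<circ> \<sigma> \<in> G" using * \<open>\<sigma> \<in> G\<close> by (simp add: S)
  ultimately show "x = y" using orbit_sparseD[OF L G uv(1,2), of "finv \<sigma> \<circ> \<gamma> \<circ> \<sigma>"] uv by simp
qed

lemma minimal_orbit_meets:
  assumes "acts_minimally G" "open V" "V \<noteq> {}"
  shows "\<exists>\<gamma>\<in>G. \<gamma> x \<in> V"
proof -
  have "closure (orb G x) \<inter> V \<noteq> {}" using assms unfolding acts_minimally_def by auto
  then have "orb G x \<inter> V \<noteq> {}" using open_Int_closure_eq_empty[OF assms(2)] by blast
  then show ?thesis by (auto simp: orb_def)
qed

text \<open>The involution exchanging a small neighbourhood \<open>W\<close> of \<open>M\<close> with \<open>\<gamma> W\<close> does it: sparseness keeps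
  \<open>\<gamma> M\<close> away from \<open>L\<close>.\<close>

lemma sparse_step:
  fixes G :: "('a::topological_space \<Rightarrow> 'a) set"
  assumes X: "is_cantor_space (euclidean :: 'a topology)" and G: "full_group G"
    and L: "orbit_sparse G L" and M: "M \<subseteq> L" "closed M" "closed (L - M)"
    and \<gamma>: "\<gamma> \<in> G" "\<gamma> ` M \<subseteq> V" "M \<inter> V = {}" and V: "clopen V"
    and E: "clopen E" "M \<subseteq> E" "V \<subseteq> E"
  shows "\<exists>\<sigma>\<in>G. \<sigma> ` M \<subseteq> V \<and> (\<forall>x\<in>L - M. \<sigma> x = x) \<and> (\<forall>x. x \<notin> E \<longrightarrow> \<sigma> x = x)"
proof -
  note S = subgroup_homeoD[OF full_subgroup[OF G]]
  have [simp]: "\<gamma> \<in> Homeo" using \<gamma> by (simp add: S)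
  \<comment> \<open>What the neighbourhood \<open>W\<close> has to avoid: the rest of
    \<open>L\<close> and the points sent by \<open>\<gamma>\<close> into \<open>L\<close>, so that
    \<open>L - M\<close> is left fixed; the complement of \<open>E\<close>; \<open>V\<close> and the
    points not sent into \<open>V\<close>, so that \<open>\<gamma>(W)\<close> lies in
    \<open>V\<close> and is disjoint from \<open>W\<close>.\<close>
  let ?C = "(L - M) \<union> \<gamma> -` L \<union> - E \<union> V \<union> - (\<gamma> -` V)"
  have C1: "closed ?C"
    using M V E orbit_sparse_closed[OF L] Homeo_closed_vimage[OF \<open>\<gamma> \<in> Homeo\<close>]
      Homeo_open_vimage[OF \<open>\<gamma> \<in> Homeo\<close>, of V]
    by (intro closed_Un) (auto simp: clopen_def closed_Compl)
  have C2: "M \<inter> ?C = {}"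
  proof -
    \<comment> \<open>If \<open>\<gamma> x\<close> were in \<open>L\<close>, sparseness would give
      \<open>\<gamma> x = x\<close>, a point of both \<open>V\<close> and \<open>M\<close>.\<close>
    have "x \<notin> \<gamma> -` L" if "x \<in> M" for x
      using orbit_sparseD[OF L full_subgroup[OF G] _ _ \<gamma>(1) refl, of x] that \<gamma> M by auto
    then show ?thesis using \<gamma> E by blast
  qed
  obtain W where W: "clopen W" "M \<subseteq> W" "W \<inter> ?C = {}"
    using clopen_separation[OF X M(2) C1 C2] by metis
  have W': "x \<notin> L - M" "\<gamma> x \<notin> L" "x \<in> E" "x \<notin> V" "\<gamma> x \<in> V" "\<gamma> x \<in> E" if "x \<in> W" for x
    using W(3) that E(3) by blast+
  have disj: "W \<inter> \<gamma> ` W = {}" using W'(4,5) by blast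
  let ?\<sigma> = "\<lambda>x. if x \<in> W then \<gamma> x else if x \<in> \<gamma> ` W then finv \<gamma> x else x"
  have "?\<sigma> \<in> G" by (rule full_swap[OF G \<gamma>(1) W(1) disj])
  moreover have "?\<sigma> ` M \<subseteq> V" using W(2) \<gamma> by auto
  moreover have "\<forall>x\<in>L - M. ?\<sigma> x = x" using W' by auto
  moreover have "\<forall>x. x \<notin> E \<longrightarrow> ?\<sigma> x = x" using W' E by auto
  ultimately show ?thesis by (intro bexI[of _ ?\<sigma>]) auto
qed

text \<open>Induction on the finite set of available elements. The part of \<open>M\<close> that
  only the new \<open>\<gamma>\<close> serves is moved first, with the rest of \<open>L\<close>
  fixed; the induction hypothesis then treats the remainder inside the displaced set.\<close>

lemma sparse_move_cover:
  fixes G :: "('a::topological_space \<Rightarrow> 'a) set"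
  assumes X: "is_cantor_space (euclidean :: 'a topology)" and G: "full_group G"
    and V: "clopen V" and E: "clopen E" "V \<subseteq> E"
    and "finite T" "T \<subseteq> G" "orbit_sparse G L" "M \<subseteq> L" "closed M" "closed (L - M)"
    and "M \<subseteq> E" "M \<subseteq> V \<union> (\<Union>\<gamma>\<in>T. \<gamma> -` V)"
  shows "\<exists>\<sigma>\<in>G. \<sigma> ` M \<subseteq> V \<and> (\<forall>x\<in>L - M. \<sigma> x = x) \<and> (\<forall>x. x \<notin> E \<longrightarrow> \<sigma> x = x)"
  using assms(6-)
proof (induction T arbitrary: L M rule: finite_induct)
  case empty
  then show ?case
    using subgroup_homeoD(2)[OF full_subgroup[OF G]] by (intro bexI[of _ id]) auto
next
  case (insert \<gamma> T)
  note S = subgroup_homeoD[OF full_subgroup[OF G]]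
  have \<gamma>: "\<gamma> \<in> G" using insert.prems by blast
  \<comment> \<open>Cutting \<open>M\<close> along a clopen set keeps both \<open>M1\<close> and
    \<open>M - M1\<close> closed.\<close>
  define M1 where "M1 = M - (V \<union> (\<Union>\<gamma>\<in>T. \<gamma> -` V))"
  have cl: "clopen (V \<union> (\<Union>\<gamma>\<in>T. \<gamma> -` V))"
    using V insert S by (intro clopen_basic clopen_UN Homeo_clopen_vimage) auto
  have M1: "M1 \<subseteq> M" "closed M1" unfolding M1_def using cl insert by (auto simp: clopen_def)
  have "M - M1 = M \<inter> (V \<union> (\<Union>\<gamma>\<in>T. \<gamma> -` V))" by (auto simp: M1_def)
  then have MM1: "closed (M - M1)" using cl insert by (auto simp: clopen_def)
  have "L - M1 = (L - M) \<union> (M - M1)" using insert M1 by auto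
  then have "closed (L - M1)" using MM1 insert by auto
  moreover have M1L: "M1 \<subseteq> L" "\<gamma> ` M1 \<subseteq> V" "M1 \<inter> V = {}" "M1 \<subseteq> E"
    using insert.prems by (auto simp: M1_def)
  ultimately obtain \<sigma>1 where \<sigma>1: "\<sigma>1 \<in> G" "\<sigma>1 ` M1 \<subseteq> V" "\<forall>x\<in>L - M1. \<sigma>1 x = x" "\<forall>x. x \<notin> E \<longrightarrow> \<sigma>1 x = x"
    using sparse_step[OF X G insert.prems(2) _ M1(2) _ \<gamma> _ _ V E(1) _ E(2)] M1L by blast
  have [simp]: "\<sigma>1 \<in> Homeo" using \<sigma>1 by (simp add: S)
  have fixed: "\<sigma>1 ` A = A" if "A \<subseteq> L - M1" for A using \<sigma>1(3) that by force
  have fixMM: "\<sigma>1 ` (M - M1) = M - M1" using fixed[of "M - M1"] insert.prems(3) by blast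
  have sub: "M - M1 \<subseteq> \<sigma>1 ` L" using fixed[of "M - M1"] insert.prems(2)
    by (metis Diff_mono Diff_subset image_mono insert.prems(3) order_refl order_trans)
  have "\<sigma>1 ` L - (M - M1) = \<sigma>1 ` (L - (M - M1))"
    using fixed[of "M - M1"] insert.prems image_set_diff[OF bij_is_inj[OF Homeo_bij[OF \<open>\<sigma>1 \<in> Homeo\<close>]], of L "M - M1"] by auto
  also have "L - (M - M1) = (L - M) \<union> M1" using M1 insert by auto
  finally have cl2: "closed (\<sigma>1 ` L - (M - M1))"
    using insert.prems(5) M1(2) by (simp add: Homeo_closed closed_Un)
  have "orbit_sparse G (\<sigma>1 ` L)"
    using orbit_sparse_image[OF full_subgroup[OF G]] \<sigma>1 insert by blast
  moreover have "M - M1 \<subseteq> E" "M - M1 \<subseteq> V \<union> (\<Union>\<gamma>\<in>T. \<gamma> -` V)"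
    using insert.prems(6) by (auto simp: M1_def)
  ultimately obtain \<sigma>2 where \<sigma>2: "\<sigma>2 \<in> G" "\<sigma>2 ` (M - M1) \<subseteq> V"
      "\<forall>x\<in>\<sigma>1 ` L - (M - M1). \<sigma>2 x = x" "\<forall>x. x \<notin> E \<longrightarrow> \<sigma>2 x = x"
    using insert.IH[of "\<sigma>1 ` L" "M - M1"] sub MM1 cl2 insert.prems(1) by auto
  show ?case
  proof (intro bexI[of _ "\<sigma>2 \<circ> \<sigma>1"] conjI ballI allI impI)
    show "(\<sigma>2 \<circ> \<sigma>1) ` M \<subseteq> V"
    proof
      fix y assume "y \<in> (\<sigma>2 \<circ> \<sigma>1) ` M"
      then obtain x where x: "x \<in> M" "y = \<sigma>2 (\<sigma>1 x)" by auto
      show "y \<in> V"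
      proof (cases "x \<in> M1")
        case True
        \<comment> \<open>By injectivity \<open>\<sigma>1 x\<close> stays off \<open>M - M1\<close>,
          which \<open>\<sigma>1\<close> fixes pointwise. Hence the second move leaves it where it
          is, already in \<open>V\<close>.\<close>
        then have "\<sigma>1 x \<notin> M - M1"
          using fixMM by (metis DiffE Homeo_mem_image_f \<open>\<sigma>1 \<in> Homeo\<close>)
        then have "\<sigma>1 x \<in> \<sigma>1 ` L - (M - M1)" using x insert.prems(3) by blast
        then have "\<sigma>2 (\<sigma>1 x) = \<sigma>1 x" using \<sigma>2(3) by blast
        then show ?thesis using True x(2) \<sigma>1(2) by auto
      next
        case False
        then have "\<sigma>1 x = x" "x \<in> M - M1" using x \<sigma>1(3) insert.prems(3) by auto
        then show ?thesis using x(2) \<sigma>2(2) by auto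
      qed
    qed
    show "(\<sigma>2 \<circ> \<sigma>1) x = x" if "x \<in> L - M" for x
    proof -
      have 1: "\<sigma>1 x = x" using that \<sigma>1(3) M1 by blast
      then have "x \<in> \<sigma>1 ` L - (M - M1)" using that by (auto simp: image_iff) metis
      then show ?thesis using 1 \<sigma>2(3) by simp
    qed
    show "(\<sigma>2 \<circ> \<sigma>1) x = x" if "x \<notin> E" for x using that \<sigma>1 \<sigma>2 by auto
    show "\<sigma>2 \<circ> \<sigma>1 \<in> G" using \<sigma>1 \<sigma>2 by (simp add: S)
  qed
qed

text \<open>By minimality the sets \<open>\<gamma> -\<close> followed by \<open>V\<close> cover
  \<open>M\<close>, and compactness leaves finitely many elements to use.\<close>

lemma sparse_move:
  fixes G :: "('a::topological_space \<Rightarrow> 'a) set"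
  assumes X: "is_cantor_space (euclidean :: 'a topology)" and G: "full_group G"
    and min: "acts_minimally G"
    and V: "clopen V" "M \<noteq> {} \<Longrightarrow> V \<noteq> {}" and E: "clopen E" "V \<subseteq> E"
    and L: "orbit_sparse G L" "M \<subseteq> L" "closed M" "closed (L - M)" "M \<subseteq> E"
  shows "\<exists>\<sigma>\<in>G. \<sigma> ` M \<subseteq> V \<and> (\<forall>x\<in>L - M. \<sigma> x = x) \<and> (\<forall>x. x \<notin> E \<longrightarrow> \<sigma> x = x)"
proof -
  have "M \<subseteq> (\<Union>\<gamma>\<in>G. \<gamma> -` V)"
    using minimal_orbit_meets[OF min, of V] V by (fastforce simp: clopen_def)
  moreover have "open (\<gamma> -` V)" if "\<gamma> \<in> G" for \<gamma>
    using subgroup_homeoD(1)[OF full_subgroup[OF G] that] V Homeo_open_vimage unfolding clopen_def by blast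
  ultimately obtain T where "T \<subseteq> G" "finite T" "M \<subseteq> (\<Union>\<gamma>\<in>T. \<gamma> -` V)"
    using compactE_image[OF cantor_compact[OF X L(3)], of G "\<lambda>\<gamma>. \<gamma> -` V"] by blast
  then show ?thesis using sparse_move_cover[OF X G V(1) E, of T L M] L by blast
qed

text \<open>The pieces are moved one at a time, each move fixing the pieces already placed and those
  still waiting. The confining sets \<open>E i\<close> may coincide or overlap, so the control on
  \<open>\<sigma>\<close> is phrased through the sets \<open>Z\<close> that cut none of
  them.\<close>

lemma sparse_move_family:
  fixes G :: "('a::topological_space \<Rightarrow> 'a) set"
  assumes X: "is_cantor_space (euclidean :: 'a topology)" and G: "full_group G"
    and min: "acts_minimally G"
    and L: "orbit_sparse G (\<Union>i\<in>I. M i)" and "finite I"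
    and M: "\<And>i. i \<in> I \<Longrightarrow> closed (M i)"
    and disj: "\<And>i j. i \<in> I \<Longrightarrow> j \<in> I \<Longrightarrow> i \<noteq> j \<Longrightarrow> M i \<inter> M j = {}"
    and V: "\<And>i. i \<in> I \<Longrightarrow> clopen (V i)" "\<And>i. i \<in> I \<Longrightarrow> M i \<noteq> {} \<Longrightarrow> V i \<noteq> {}"
    and E: "\<And>i. i \<in> I \<Longrightarrow> clopen (E i)" "\<And>i. i \<in> I \<Longrightarrow> V i \<subseteq> E i" "\<And>i. i \<in> I \<Longrightarrow> M i \<subseteq> E i"
  shows "\<exists>\<sigma>\<in>G. (\<forall>i\<in>I. \<sigma> ` M i \<subseteq> V i) \<and>
    (\<forall>Z. (\<forall>i\<in>I. E i \<subseteq> Z \<or> E i \<inter> Z = {}) \<longrightarrow> (\<forall>x. \<sigma> x \<in> Z \<longleftrightarrow> x \<in> Z))"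
proof -
  note S = subgroup_homeoD[OF full_subgroup[OF G]]
  have "\<exists>\<sigma>\<in>G. (\<forall>i\<in>J. \<sigma> ` M i \<subseteq> V i) \<and> (\<forall>i\<in>I - J. \<forall>x\<in>M i. \<sigma> x = x) \<and>
    (\<forall>Z. (\<forall>i\<in>I. E i \<subseteq> Z \<or> E i \<inter> Z = {}) \<longrightarrow> (\<forall>x. \<sigma> x \<in> Z \<longleftrightarrow> x \<in> Z))" if "finite J" "J \<subseteq> I" for J
    using that
  proof (induction J rule: finite_induct)
    case empty
    then show ?case using S by (intro bexI[of _ id]) auto
  next
    case (insert j J)
    then obtain \<sigma> where \<sigma>: "\<sigma> \<in> G" "\<forall>i\<in>J. \<sigma> ` M i \<subseteq> V i" "\<forall>i\<in>I - J. \<forall>x\<in>M i. \<sigma> x = x"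
      and \<sigma>Z: "\<And>Z x. (\<forall>i\<in>I. E i \<subseteq> Z \<or> E i \<inter> Z = {}) \<Longrightarrow> \<sigma> x \<in> Z \<longleftrightarrow> x \<in> Z"
      by auto
    have [simp]: "\<sigma> \<in> Homeo" using \<sigma> by (simp add: S)
    let ?L = "\<Union>i\<in>I. M i"
    have j: "j \<in> I" "j \<notin> J" using insert by auto
    have Mj: "\<sigma> ` M j = M j" using \<sigma>(3) j by force
    have "?L - M j = (\<Union>i\<in>I - {j}. M i)" using disj j by fastforce
    then have "closed (?L - M j)" using M \<open>finite I\<close> by auto
    moreover have "\<sigma> ` ?L - M j = \<sigma> ` (?L - M j)"
      using Mj by (metis Homeo_bij \<open>\<sigma> \<in> Homeo\<close> bij_is_inj image_set_diff)
    ultimately have "closed (\<sigma> ` ?L - M j)" by (simp add: Homeo_closed)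
    moreover have "M j \<subseteq> \<sigma> ` ?L" using Mj j by blast
    ultimately obtain \<tau> where \<tau>: "\<tau> \<in> G" "\<tau> ` M j \<subseteq> V j" "\<forall>x\<in>\<sigma> ` ?L - M j. \<tau> x = x"
        "\<forall>x. x \<notin> E j \<longrightarrow> \<tau> x = x"
      using sparse_move[OF X G min V(1)[OF j(1)] V(2)[OF j(1)] E(1,2)[OF j(1)]
          orbit_sparse_image[OF full_subgroup[OF G] \<sigma>(1) L], of "M j"] M[OF j(1)] E(3)[OF j(1)]
      by blast
    have [simp]: "\<tau> \<in> Homeo" using \<tau> by (simp add: S)
    have \<tau>fix: "\<tau> (\<sigma> x) = \<sigma> x" if "x \<in> M i" "i \<in> I" "i \<noteq> j" for x i
    proof -
      have "x \<notin> M j" using disj[OF that(2) j(1) that(3)] that(1) by blast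
      then have "\<sigma> x \<notin> M j" using Mj by (metis Homeo_mem_image_f \<open>\<sigma> \<in> Homeo\<close>)
      then show ?thesis using \<tau>(3) that by auto
    qed
    \<comment> \<open>An injective map that is the identity off \<open>E j\<close> sends no point of
      \<open>E j\<close> outside.\<close>
    have \<tau>E: "\<tau> x \<in> E j \<longleftrightarrow> x \<in> E j" for x
      using \<tau>(4) by (metis Homeo_eq_iff \<open>\<tau> \<in> Homeo\<close>)
    show ?case
    proof (intro bexI[of _ "\<tau> \<circ> \<sigma>"] conjI ballI allI impI)
      show "(\<tau> \<circ> \<sigma>) ` M i \<subseteq> V i" if "i \<in> insert j J" for i
      proof (cases "i = j")
        case True
        then show ?thesis using \<tau>(2) Mj by (metis image_comp)
      next
        case False
        then have "(\<tau> \<circ> \<sigma>) ` M i = \<sigma> ` M i" using \<tau>fix that insert.prems by force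
        then show ?thesis using \<sigma> that False by auto
      qed
      show "(\<tau> \<circ> \<sigma>) x = x" if "i \<in> I - insert j J" "x \<in> M i" for i x
        using \<tau>fix that \<sigma>(3) by auto
      show "(\<tau> \<circ> \<sigma>) x \<in> Z \<longleftrightarrow> x \<in> Z" if Z: "\<forall>i\<in>I. E i \<subseteq> Z \<or> E i \<inter> Z = {}" for Z x
      proof -
        have "\<tau> y \<in> Z \<longleftrightarrow> y \<in> Z" for y
          using Z j \<tau>E[of y] \<tau>(4) by (cases "y \<in> E j") auto
        then show ?thesis using \<sigma>Z[OF Z] by simp
      qed
      show "\<tau> \<circ> \<sigma> \<in> G" using \<sigma> \<tau> by (simp add: S)
    qed
  qed
  from this[OF \<open>finite I\<close> order_refl] show ?thesis by auto
qed

section \<open>Finite groups and finite clopen families\<close>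

text \<open>The classes of \<open>sig F\<close> are the atoms of the Boolean algebra generated by \<open>F\<close>.\<close>

definition sig :: "'a set set \<Rightarrow> 'a \<Rightarrow> 'a set set" where
  "sig F x = {U \<in> F. x \<in> U}"

lemma sig_eq_iff: "sig F x = sig F y \<longleftrightarrow> (\<forall>U\<in>F. x \<in> U \<longleftrightarrow> y \<in> U)"
  by (auto simp: sig_def)

lemma sig_subset: "sig F x \<subseteq> F"
  by (auto simp: sig_def)

lemma sig_restrict: "F \<subseteq> F' \<Longrightarrow> sig F x = sig F' x \<inter> F"
  by (auto simp: sig_def)

lemma sig_mono: "F \<subseteq> F' \<Longrightarrow> sig F' x = sig F' y \<Longrightarrow> sig F x = sig F y"
  by (simp add: sig_restrict)

lemma clopen_sig:
  assumes "finite F" "\<And>U. U \<in> F \<Longrightarrow> clopen U"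
  shows "clopen {x. sig F x = s}"
proof (cases "s \<subseteq> F")
  case True
  then have "{x. sig F x = s} = (\<Inter>U\<in>F. if U \<in> s then U else - U)"
    by (auto simp: sig_def split: if_splits)
  also have "clopen \<dots>" using assms by (intro clopen_INT) auto
  finally show ?thesis .
next
  case False
  then have "{x. sig F x = s} = {}" using sig_subset[of F] by auto
  then show ?thesis by auto
qed

text \<open>The images of the atoms under \<open>g\<close> partition the space, and each
  \<open>\<phi> s\<close> maps its atom onto the corresponding image; hence the glued map is a
  bijection. For a signature \<open>s\<close> that no point has, both images are empty.\<close>

lemma atomwise_glue:
  assumes F: "finite F" "\<And>U. U \<in> F \<Longrightarrow> clopen U" and g: "g \<in> Homeo"
    and \<phi>: "\<And>s. s \<subseteq> F \<Longrightarrow> \<phi> s \<in> Homeo"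
    and img: "\<And>s. s \<subseteq> F \<Longrightarrow> \<phi> s ` {x. sig F x = s} = g ` {x. sig F x = s}"
  shows "(\<lambda>x. \<phi> (sig F x) x) \<in> Homeo"
    and "sig F (finv g (\<phi> (sig F x) x)) = sig F x"
proof -
  let ?f = "\<lambda>x. \<phi> (sig F x) x"
  have sig: "sig F (finv g (?f x)) = sig F x" for x
  proof -
    have "?f x \<in> \<phi> (sig F x) ` {y. sig F y = sig F x}" by simp
    then have "?f x \<in> g ` {y. sig F y = sig F x}" by (simp only: img[OF sig_subset])
    then show ?thesis using g by (simp only: Homeo_mem_image mem_Collect_eq)
  qed
  then show "sig F (finv g (?f x)) = sig F x" .
  have "inj ?f"
  proof (rule injI)
    fix x y assume eq: "?f x = ?f y"
    then have "sig F x = sig F y" using sig by metis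
    then show "x = y" using eq \<phi>[OF sig_subset, of x] by simp
  qed
  moreover have "surj ?f"
  proof (rule surjI)
    fix y
    let ?s = "sig F (finv g y)"
    have "y \<in> g ` {x. sig F x = ?s}" using g by (simp add: Homeo_mem_image)
    then have "y \<in> \<phi> ?s ` {x. sig F x = ?s}" using img[OF sig_subset, of "finv g y"] by simp
    then show "?f (finv (\<phi> ?s) y) = y"
      using \<phi>[OF sig_subset, of "finv g y"] by (auto simp: Homeo_mem_image)
  qed
  ultimately have "bij ?f" by (simp add: bij_def)
  then show "?f \<in> Homeo"
  proof (rule Homeo_glue[of _ "Pow F" "\<lambda>s. {x. sig F x = s}" \<phi>])
    show "\<exists>s\<in>Pow F. x \<in> {x. sig F x = s}" for x using sig_subset[of F x] by auto
    show "open {x. sig F x = s}" for s using clopen_sig[OF F] by (simp add: clopen_def)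
  qed (use \<phi> in auto)
qed

text \<open>Refine \<open>F\<close> by \<open>U\<close>. On each atom \<open>g\<close> is some
  \<open>\<nu> \<circ> \<gamma>\<close>, and \<open>\<gamma>\<close> can be replaced by an element
  of \<open>G'\<close> with the same image of the atom. Gluing gives an element of the full group
  \<open>G'\<close> agreeing with \<open>g\<close> on all atoms as sets, hence on
  \<open>U\<close>.\<close>

lemma piecewise_transfer:
  assumes G': "full_group G'" and G: "G \<subseteq> Homeo"
    and same: "\<And>\<gamma> U. \<gamma> \<in> G \<Longrightarrow> clopen U \<Longrightarrow> \<exists>\<nu>\<in>G'. \<nu> ` U = \<gamma> ` U"
    and g: "g \<in> Homeo" and F: "finite F" "\<And>U. U \<in> F \<Longrightarrow> clopen U"
    and pieces: "\<And>s. s \<subseteq> F \<Longrightarrow> \<exists>\<nu>\<in>G'. \<exists>\<gamma>\<in>G. \<forall>x. sig F x = s \<longrightarrow> g x = \<nu> (\<gamma> x)"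
    and U: "clopen U"
  shows "\<exists>\<nu>\<in>G'. \<nu> ` U = g ` U"
proof -
  note S = subgroup_homeoD[OF full_subgroup[OF G']]
  let ?F = "insert U F"
  have F': "finite ?F" "\<And>V. V \<in> ?F \<Longrightarrow> clopen V" using F U by auto
  have "\<exists>\<phi>\<in>G'. \<phi> ` {x. sig ?F x = s} = g ` {x. sig ?F x = s}" if "s \<subseteq> ?F" for s
  proof -
    obtain \<nu> \<gamma> where *: "\<nu> \<in> G'" "\<gamma> \<in> G" "\<forall>x. sig F x = s \<inter> F \<longrightarrow> g x = \<nu> (\<gamma> x)"
      using pieces[of "s \<inter> F"] by blast
    obtain \<mu> where \<mu>: "\<mu> \<in> G'" "\<mu> ` {x. sig ?F x = s} = \<gamma> ` {x. sig ?F x = s}"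
      using same[OF *(2) clopen_sig[OF F']] by blast
    have "(\<nu> \<circ> \<mu>) ` {x. sig ?F x = s} = \<nu> ` \<gamma> ` {x. sig ?F x = s}" using \<mu>(2) by (metis image_comp)
    also have "\<dots> = g ` {x. sig ?F x = s}"
      using *(3) sig_restrict[of F ?F] by (force simp: image_image intro!: image_cong)
    finally show ?thesis using S(3)[OF *(1) \<mu>(1)] by blast
  qed
  then obtain \<phi> where \<phi>: "\<And>s. s \<subseteq> ?F \<Longrightarrow> \<phi> s \<in> G'"
      "\<And>s. s \<subseteq> ?F \<Longrightarrow> \<phi> s ` {x. sig ?F x = s} = g ` {x. sig ?F x = s}"
    by metis
  let ?f = "\<lambda>x. \<phi> (sig ?F x) x"
  have f: "?f \<in> Homeo" and sig: "\<And>x. sig ?F (finv g (?f x)) = sig ?F x"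
    using atomwise_glue[OF F' g S(1)[OF \<phi>(1)] \<phi>(2)] by blast+
  have "?f \<in> G'"
  proof (rule fullD[OF G' f, of "\<phi> ` Pow ?F"])
    show "\<exists>\<gamma>\<in>\<phi> ` Pow ?F. ?f x = \<gamma> x" for x
      by (rule bexI[of _ "\<phi> (sig ?F x)"]) (use sig_subset[of ?F x] in auto)
  qed (use F' \<phi>(1) in auto)
  moreover have "?f ` U = g ` U"
  proof -
    have iff: "finv g (?f x) \<in> U \<longleftrightarrow> x \<in> U" for x using sig[of x] by (auto simp: sig_eq_iff)
    show ?thesis
    proof (rule Set.set_eqI)
      fix y
      have "y \<in> ?f ` U \<longleftrightarrow> finv ?f y \<in> U" by (rule Homeo_mem_image[OF f])
      also have "\<dots> \<longleftrightarrow> finv g y \<in> U" using iff[of "finv ?f y"] Homeo_f_inv[OF f, of y] by simp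
      finally show "y \<in> ?f ` U \<longleftrightarrow> y \<in> g ` U" using Homeo_mem_image[OF g] by metis
    qed
  qed
  ultimately show ?thesis by blast
qed

section \<open>Finite groups permuting the atoms of a clopen family\<close>

text \<open>The last condition says that an element of \<open>\<Delta>\<close> that preserves an atom of \<open>F\<close> fixes it
  pointwise.\<close>

definition adapted :: "('a::topological_space \<Rightarrow> 'a) set \<Rightarrow> 'a set set \<Rightarrow> bool" where
  "adapted \<Delta> F \<longleftrightarrow> finite F \<and> (\<forall>U\<in>F. clopen U) \<and> (\<forall>\<delta>\<in>\<Delta>. \<forall>U\<in>F. \<delta> ` U \<in> F) \<and>
     (\<forall>\<delta>\<in>\<Delta>. \<forall>x. sig F (\<delta> x) = sig F x \<longrightarrow> \<delta> x = x)"

lemma adapted_subgroup: "adapted \<Delta>' F \<Longrightarrow> \<Delta> \<subseteq> \<Delta>' \<Longrightarrow> adapted \<Delta> F"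
  unfolding adapted_def by blast

lemma sig_equivariant:
  assumes \<Delta>: "subgroup \<Delta> homeo_group" and F: "adapted \<Delta> F" and \<delta>: "\<delta> \<in> \<Delta>" and sig: "sig F x = sig F y"
  shows "sig F (\<delta> x) = sig F (\<delta> y)"
  unfolding sig_eq_iff
proof
  fix U assume "U \<in> F"
  moreover have "finv \<delta> \<in> \<Delta>" using \<delta> by (simp add: subgroup_homeoD[OF \<Delta>])
  ultimately have "finv \<delta> ` U \<in> F" using F unfolding adapted_def by metis
  then have "x \<in> finv \<delta> ` U \<longleftrightarrow> y \<in> finv \<delta> ` U" using sig by (simp add: sig_eq_iff)
  then show "\<delta> x \<in> U \<longleftrightarrow> \<delta> y \<in> U"
    using subgroup_homeoD(1)[OF \<Delta> \<delta>] by (simp add: Homeo_mem_image Homeo_inv)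
qed

text \<open>A set meeting each orbit of a group \<open>\<Delta>\<close> in exactly one point. The
  action need not be free, so the \<open>\<delta>\<close> carrying \<open>x\<close> into
  \<open>P\<close> need not be unique.\<close>

definition fundamental_domain :: "('a \<Rightarrow> 'a) set \<Rightarrow> 'a set \<Rightarrow> bool" where
  "fundamental_domain \<Delta> P \<longleftrightarrow> (\<forall>x. \<exists>\<delta>\<in>\<Delta>. \<delta> x \<in> P) \<and> (\<forall>\<delta>\<in>\<Delta>. \<forall>x\<in>P. \<delta> x \<in> P \<longrightarrow> \<delta> x = x)"

text \<open>Number the atoms arbitrarily and keep, in each \<open>\<Delta>\<close>-orbit of atoms,
  the one with the least number. An element returning a point of \<open>P\<close> to
  \<open>P\<close> preserves its atom, so by adaptedness it fixes the point.\<close>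

lemma adapted_fundamental_domain:
  assumes \<Delta>: "subgroup \<Delta> homeo_group" "finite \<Delta>" and F: "adapted \<Delta> F"
  obtains P where "clopen P" "fundamental_domain \<Delta> P"
    "\<forall>x y. sig F x = sig F y \<longrightarrow> x \<in> P \<longrightarrow> y \<in> P"
proof -
  note S = subgroup_homeoD[OF \<Delta>(1)]
  have fin: "finite F" "\<And>U. U \<in> F \<Longrightarrow> clopen U" using F by (auto simp: adapted_def)
  obtain e :: "'a set set \<Rightarrow> nat" where e: "inj_on e (Pow F)"
    using finite_imp_inj_to_nat_seg[of "Pow F"] fin by auto
  define f where "f x = e (sig F x)" for x
  have f_eq: "f x = f y \<longleftrightarrow> sig F x = sig F y" for x y
    using inj_on_eq_iff[OF e] sig_subset[of F] by (simp add: f_def)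
  define P where "P = {x. \<forall>\<delta>\<in>\<Delta>. f x \<le> f (\<delta> x)}"
  have atoms: "y \<in> P" if "sig F x = sig F y" "x \<in> P" for x y
  proof -
    have "f y \<le> f (\<delta> y)" if "\<delta> \<in> \<Delta>" for \<delta>
    proof -
      have "f x = f y" "f (\<delta> x) = f (\<delta> y)"
        using sig_equivariant[OF \<Delta>(1) F that \<open>sig F x = sig F y\<close>] \<open>sig F x = sig F y\<close>
        by (simp_all add: f_eq)
      moreover have "f x \<le> f (\<delta> x)" using \<open>x \<in> P\<close> that by (simp add: P_def)
      ultimately show ?thesis by simp
    qed
    then show ?thesis by (simp add: P_def)
  qed
  have "P = (\<Union>s\<in>sig F ` P. {x. sig F x = s})" using atoms by auto
  moreover have "finite (sig F ` P)"
    by (rule finite_subset[of _ "Pow F"]) (use fin sig_subset[of F] in auto)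
  then have "clopen (\<Union>s\<in>sig F ` P. {x. sig F x = s})" using fin by (intro clopen_UN clopen_sig) auto
  ultimately have "clopen P" by simp
  moreover have "fundamental_domain \<Delta> P"
    unfolding fundamental_domain_def
  proof (intro conjI allI ballI impI)
    fix x
    obtain \<delta> where \<delta>: "\<delta> \<in> \<Delta>" "\<And>\<epsilon>. \<epsilon> \<in> \<Delta> \<Longrightarrow> f (\<delta> x) \<le> f (\<epsilon> x)"
      using ex_min_if_finite[of "(\<lambda>\<delta>. f (\<delta> x)) ` \<Delta>"] \<Delta>(2) S(2) by (auto simp: not_less)
    have "f (\<delta> x) \<le> f (\<epsilon> (\<delta> x))" if "\<epsilon> \<in> \<Delta>" for \<epsilon>
      using \<delta>(2)[of "\<epsilon> \<circ> \<delta>"] S(3)[OF that \<delta>(1)] by simp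
    then show "\<exists>\<delta>\<in>\<Delta>. \<delta> x \<in> P" using \<delta> by (auto simp: P_def)
  next
    fix \<delta> x assume *: "\<delta> \<in> \<Delta>" "x \<in> P" "\<delta> x \<in> P"
    have "f x \<le> f (\<delta> x)" using * by (simp add: P_def)
    moreover have "f (\<delta> x) \<le> f (finv \<delta> (\<delta> x))" using * S(4) unfolding P_def by blast
    ultimately have "sig F (\<delta> x) = sig F x" using S(1)[OF *(1)] f_eq by simp
    then show "\<delta> x = x" using F * unfolding adapted_def by blast
  qed
  ultimately show thesis using that atoms by blast
qed

text \<open>Preserving \<open>sig F\<close> forces \<open>m\<close> to preserve stabilizers, which makes the extension well defined.\<close>

lemma equivariant_extension:
  assumes \<Delta>: "subgroup \<Delta> homeo_group" "finite \<Delta>" and F: "adapted \<Delta> F"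
    and P: "clopen P" "fundamental_domain \<Delta> P" "\<forall>x y. sig F x = sig F y \<longrightarrow> x \<in> P \<longrightarrow> y \<in> P"
    and m: "m \<in> Homeo" "\<And>x. sig F (m x) = sig F x"
  obtains g where "g \<in> Homeo" "\<And>\<delta> x. \<delta> \<in> \<Delta> \<Longrightarrow> g (\<delta> x) = \<delta> (g x)" "\<And>x. sig F (g x) = sig F x"
    "\<And>\<delta> x. \<delta> \<in> \<Delta> \<Longrightarrow> \<delta> x \<in> P \<Longrightarrow> g x = finv \<delta> (m (\<delta> x))"
proof -
  note S = subgroup_homeoD[OF \<Delta>(1)]
  note eqv = sig_equivariant[OF \<Delta>(1) F]
  have ex: "\<exists>\<delta>. \<delta> \<in> \<Delta> \<and> \<delta> x \<in> P" for x using P(2) by (auto simp: fundamental_domain_def)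
  define g where "g x = (let \<delta> = SOME \<delta>. \<delta> \<in> \<Delta> \<and> \<delta> x \<in> P in finv \<delta> (m (\<delta> x)))" for x
  have wd: "finv \<delta> (m (\<delta> x)) = finv \<epsilon> (m (\<epsilon> x))"
    if *: "\<delta> \<in> \<Delta>" "\<epsilon> \<in> \<Delta>" "\<delta> x \<in> P" "\<epsilon> x \<in> P" for \<delta> \<epsilon> x
  proof -
    have h: "\<delta> \<in> Homeo" "\<epsilon> \<in> Homeo" using * by (auto simp: S)
    have \<eta>: "\<epsilon> \<circ> finv \<delta> \<in> \<Delta>" using * by (simp add: S)
    moreover have "(\<epsilon> \<circ> finv \<delta>) (\<delta> x) = \<epsilon> x" using h by simp
    ultimately have z: "\<epsilon> x = \<delta> x" using P(2) * unfolding fundamental_domain_def by metis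
    \<comment> \<open>\<open>\<epsilon> \<circ> finv \<delta>\<close> fixes
      \<open>\<delta> x\<close>, so it preserves the atom of that point. This atom also contains
      \<open>m (\<delta> x)\<close>, which is therefore fixed as well.\<close>
    have "sig F ((\<epsilon> \<circ> finv \<delta>) (m (\<delta> x))) = sig F ((\<epsilon> \<circ> finv \<delta>) (\<delta> x))"
      by (rule eqv[OF \<eta>]) (rule m)
    also have "\<dots> = sig F (m (\<delta> x))" using h z m by simp
    finally have "(\<epsilon> \<circ> finv \<delta>) (m (\<delta> x)) = m (\<delta> x)" using F \<eta> unfolding adapted_def by blast
    then have "finv \<epsilon> (\<epsilon> (finv \<delta> (m (\<delta> x)))) = finv \<epsilon> (m (\<delta> x))" by simp
    then show ?thesis using h z by simp
  qed
  have gP: "g x = finv \<delta> (m (\<delta> x))" if "\<delta> \<in> \<Delta>" "\<delta> x \<in> P" for \<delta> x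
    unfolding g_def Let_def using wd someI_ex[OF ex[of x]] that by blast
  have sig: "sig F (g x) = sig F x" for x
  proof -
    obtain \<delta> where \<delta>: "\<delta> \<in> \<Delta>" "\<delta> x \<in> P" using ex by blast
    have "sig F (finv \<delta> (m (\<delta> x))) = sig F (finv \<delta> (\<delta> x))" by (rule eqv[OF S(4)[OF \<delta>(1)] m(2)])
    then show ?thesis using gP[OF \<delta>] S(1)[OF \<delta>(1)] by simp
  qed
  have comm: "g (\<delta> x) = \<delta> (g x)" if "\<delta> \<in> \<Delta>" for \<delta> x
  proof -
    obtain \<epsilon> where \<epsilon>: "\<epsilon> \<in> \<Delta>" "\<epsilon> (\<delta> x) \<in> P" using ex by blast
    have h: "\<delta> \<in> Homeo" "\<epsilon> \<in> Homeo" using \<epsilon> that by (auto simp: S)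
    have "g x = finv (\<epsilon> \<circ> \<delta>) (m ((\<epsilon> \<circ> \<delta>) x))" using \<epsilon> that by (intro gP) (auto simp: S)
    also have "\<dots> = finv \<delta> (g (\<delta> x))" using gP[OF \<epsilon>] h by (simp add: Homeo_inv_comp)
    finally show ?thesis using h by simp
  qed
  have "inj g"
  proof (rule injI)
    fix x y assume eq: "g x = g y"
    then have xy: "sig F x = sig F y" using sig by metis
    obtain \<delta> where \<delta>: "\<delta> \<in> \<Delta>" "\<delta> x \<in> P" using ex by blast
    \<comment> \<open>\<open>x\<close> and \<open>y\<close> share an atom and \<open>P\<close> is a
      union of atoms, so a single \<open>\<delta>\<close> computes both values and injectivity of
      \<open>m\<close> applies.\<close>
    have "\<delta> y \<in> P" using P(3) eqv[OF \<delta>(1) xy] \<delta>(2) by blast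
    then show "x = y"
      using eq gP[OF \<delta>] gP[OF \<delta>(1)] S(1)[OF \<delta>(1)] m(1) by (simp add: Homeo_inv)
  qed
  moreover have "\<exists>x. y = g x" for y
  proof -
    obtain \<delta> where \<delta>: "\<delta> \<in> \<Delta>" "\<delta> y \<in> P" using ex by blast
    define x where "x = finv \<delta> (finv m (\<delta> y))"
    have \<delta>x: "\<delta> x = finv m (\<delta> y)" using S(1)[OF \<delta>(1)] by (simp add: x_def)
    have "sig F (finv m (\<delta> y)) = sig F (\<delta> y)" using m(2)[of "finv m (\<delta> y)"] m(1) by simp
    then have "\<delta> x \<in> P" using P(3) \<delta>(2) \<delta>x by metis
    then have "g x = y" using gP[OF \<delta>(1), of x] \<delta>x m(1) S(1)[OF \<delta>(1)] by simp
    then show ?thesis by blast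
  qed
  ultimately have "bij g" unfolding bij_def surj_def by blast
  then have "g \<in> Homeo"
  proof (rule Homeo_glue[of _ \<Delta> "\<lambda>\<delta>. \<delta> -` P" "\<lambda>\<delta>. finv \<delta> \<circ> m \<circ> \<delta>"])
    show "\<exists>\<delta>\<in>\<Delta>. x \<in> \<delta> -` P" for x using ex by auto
    show "open (\<delta> -` P)" if "\<delta> \<in> \<Delta>" for \<delta>
      using P(1) S(1)[OF that] by (simp add: clopen_def Homeo_open_vimage)
    show "finv \<delta> \<circ> m \<circ> \<delta> \<in> Homeo" if "\<delta> \<in> \<Delta>" for \<delta>
      using m(1) S(1)[OF that] by (simp add: Homeo_comp Homeo_inv)
    show "g x = (finv \<delta> \<circ> m \<circ> \<delta>) x" if "\<delta> \<in> \<Delta>" "x \<in> \<delta> -` P" for \<delta> x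
      using gP that by simp
  qed
  then show thesis using that comm sig gP by blast
qed

section \<open>The two corrections\<close>

text \<open>An equivariant \<open>\<nu>\<close> is determined on the fundamental domain
  \<open>P\<close>. If \<open>\<delta> x\<close> lies in \<open>P\<close>, then so does
  \<open>\<delta> (h x)\<close>, and all that is required is that this point be moved to the
  \<open>F'\<close>-atom of \<open>\<delta> x\<close> within its own \<open>F\<close>-atom. The
  points to be moved form a sparse set, so the moving lemma does this for all atoms at once.\<close>

lemma sparse_adjustment:
  fixes G :: "('a::topological_space \<Rightarrow> 'a) set"
  assumes X: "is_cantor_space (euclidean :: 'a topology)" and G: "full_group G" "acts_minimally G"
    and \<Delta>: "subgroup \<Delta> homeo_group" "finite \<Delta>" "\<Delta> \<subseteq> G"
    and F: "adapted \<Delta> F" "adapted \<Delta> F'" "F \<subseteq> F'"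
    and L: "orbit_sparse G L" and h: "homeomorphism K L h h'"
    and match: "\<And>x. x \<in> K \<Longrightarrow> sig F (h x) = sig F x"
  obtains \<nu> where "\<nu> \<in> G" "\<And>\<delta> x. \<delta> \<in> \<Delta> \<Longrightarrow> \<nu> (\<delta> x) = \<delta> (\<nu> x)" "\<And>x. sig F (\<nu> x) = sig F x"
    "\<And>x. x \<in> K \<Longrightarrow> sig F' (\<nu> (h x)) = sig F' x"
proof -
  note S = subgroup_homeoD[OF \<Delta>(1)]
  note SG = subgroup_homeoD[OF full_subgroup[OF G(1)]]
  note eqv = sig_equivariant[OF \<Delta>(1)]
  have fin: "finite F" "\<And>U. U \<in> F \<Longrightarrow> clopen U" "finite F'" "\<And>U. U \<in> F' \<Longrightarrow> clopen U"
    using F by (auto simp: adapted_def)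
  obtain P where P: "clopen P" "fundamental_domain \<Delta> P"
      "\<forall>x y. sig F x = sig F y \<longrightarrow> x \<in> P \<longrightarrow> y \<in> P"
    by (rule adapted_fundamental_domain[OF \<Delta>(1,2) F(1)]) blast
  have Pfix: "\<delta> x = x" if "\<delta> \<in> \<Delta>" "x \<in> P" "\<delta> x \<in> P" for \<delta> x
    using P(2) that by (auto simp: fundamental_domain_def)
  have hK: "h x \<in> L" "h' (h x) = x" if "x \<in> K" for x using h that by (auto simp: homeomorphism_def)
  have hL: "h' y \<in> K" "h (h' y) = y" if "y \<in> L" for y using h that by (auto simp: homeomorphism_def)
  \<comment> \<open>Points of the translated copy of \<open>L\<close> in one \<open>G\<close>-orbit
    coincide. Sparseness gives \<open>h x = h x'\<close>; then
    \<open>finv \<delta>' \<circ> \<delta>\<close> fixes \<open>x\<close> because \<open>P\<close>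
    meets each orbit once. As \<open>h x\<close> is in the same \<open>F\<close>-atom as
    \<open>x\<close>, adaptedness makes this element fix \<open>h x\<close> too.\<close>
  have same: "x = x' \<and> \<delta> x = \<delta>' x' \<and> \<delta> (h x) = \<delta>' (h x')"
    if *: "\<delta> \<in> \<Delta>" "\<delta>' \<in> \<Delta>" "x \<in> K" "x' \<in> K" "\<delta> x \<in> P" "\<delta>' x' \<in> P" "\<gamma> \<in> G" "\<gamma> (\<delta> (h x)) = \<delta>' (h x')"
    for \<delta> \<delta>' x x' \<gamma>
  proof -
    have hom: "\<delta> \<in> Homeo" "\<delta>' \<in> Homeo" using * S by auto
    have "finv \<delta>' \<circ> \<gamma> \<circ> \<delta> \<in> G" using * \<Delta>(3) by (intro SG(3) SG(4)) auto
    moreover have "(finv \<delta>' \<circ> \<gamma> \<circ> \<delta>) (h x) = h x'" using *(8) hom by simp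
    ultimately have "h x = h x'"
      using orbit_sparseD[OF L full_subgroup[OF G(1)] hK(1)[OF *(3)] hK(1)[OF *(4)]] by blast
    then have x: "x = x'" using hK * by metis
    have \<epsilon>: "\<delta>' \<circ> finv \<delta> \<in> \<Delta>" using * by (simp add: S)
    have "(\<delta>' \<circ> finv \<delta>) (\<delta> x) = \<delta> x" using Pfix[OF \<epsilon> *(5)] *(6) x hom by simp
    then have eq: "\<delta>' x = \<delta> x" using hom by simp
    have \<eta>: "finv \<delta>' \<circ> \<delta> \<in> \<Delta>" using * by (simp add: S)
    have "(finv \<delta>' \<circ> \<delta>) x = x" using hom eq[symmetric] by simp
    then have "sig F ((finv \<delta>' \<circ> \<delta>) (h x)) = sig F (h x)"
      using eqv[OF F(1) \<eta> match[OF *(3)]] match[OF *(3)] by simp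
    then have "(finv \<delta>' \<circ> \<delta>) (h x) = h x" using F(1) \<eta> unfolding adapted_def by blast
    then have "\<delta> (h x) = \<delta>' (h x)" using hom by (metis Homeo_f_inv comp_apply)
    then show ?thesis using x eq by simp
  qed
  \<comment> \<open>The representatives in \<open>P\<close> of the points of \<open>L\<close> that
    have to end up in the \<open>F'\<close>-atom \<open>s\<close>. This form, in terms of
    \<open>h'\<close>, exhibits closedness.\<close>
  define M where "M s = (\<Union>\<delta>\<in>\<Delta>. \<delta> ` (L \<inter> h' -` (\<delta> -` (P \<inter> {z. sig F' z = s}))))" for s
  have M_iff: "z \<in> M s \<longleftrightarrow> (\<exists>\<delta>\<in>\<Delta>. \<exists>x\<in>K. z = \<delta> (h x) \<and> \<delta> x \<in> P \<and> sig F' (\<delta> x) = s)" for z s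
  proof
    assume "z \<in> M s"
    then obtain \<delta> y where "\<delta> \<in> \<Delta>" "y \<in> L" "z = \<delta> y" "\<delta> (h' y) \<in> P" "sig F' (\<delta> (h' y)) = s"
      by (auto simp: M_def)
    then show "\<exists>\<delta>\<in>\<Delta>. \<exists>x\<in>K. z = \<delta> (h x) \<and> \<delta> x \<in> P \<and> sig F' (\<delta> x) = s"
      using hL by (intro bexI[of _ \<delta>] bexI[of _ "h' y"]) auto
  next
    assume "\<exists>\<delta>\<in>\<Delta>. \<exists>x\<in>K. z = \<delta> (h x) \<and> \<delta> x \<in> P \<and> sig F' (\<delta> x) = s"
    then obtain \<delta> x where "\<delta> \<in> \<Delta>" "x \<in> K" "z = \<delta> (h x)" "\<delta> x \<in> P" "sig F' (\<delta> x) = s" by blast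
    then show "z \<in> M s" using hK unfolding M_def by (intro UN_I[of \<delta>] image_eqI[of _ _ "h x"]) auto
  qed
  have Mcl: "closed (M s)" for s
  proof -
    have "closed (\<delta> ` (L \<inter> h' -` (\<delta> -` (P \<inter> {z. sig F' z = s}))))" if "\<delta> \<in> \<Delta>" for \<delta>
    proof -
      have "clopen (\<delta> -` (P \<inter> {z. sig F' z = s}))"
        using P(1) clopen_sig[OF fin(3,4)] S(1)[OF that] by (intro Homeo_clopen_vimage clopen_basic)
      moreover have "continuous_on L h'" using h by (simp add: homeomorphism_def)
      ultimately have "closed (h' -` (\<delta> -` (P \<inter> {z. sig F' z = s})) \<inter> L)"
        using orbit_sparse_closed[OF L] by (metis clopen_def continuous_on_closed_vimage)
      then show ?thesis using S(1)[OF that] by (simp add: Homeo_closed Int_commute)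
    qed
    then show ?thesis unfolding M_def using \<Delta>(2) by auto
  qed
  have "orbit_sparse G (\<Union>s\<in>Pow F'. M s)"
  proof (rule orbit_sparseI[OF full_subgroup[OF G(1)]])
    show "closed (\<Union>s\<in>Pow F'. M s)" using Mcl fin by auto
    fix y z \<gamma> assume *: "y \<in> (\<Union>s\<in>Pow F'. M s)" "z \<in> (\<Union>s\<in>Pow F'. M s)" "\<gamma> \<in> G" "\<gamma> y = z"
    then obtain \<delta> x \<delta>' x' where "\<delta> \<in> \<Delta>" "\<delta>' \<in> \<Delta>" "x \<in> K" "x' \<in> K" "\<delta> x \<in> P" "\<delta>' x' \<in> P"
        "y = \<delta> (h x)" "z = \<delta>' (h x')"
      by (auto simp: M_iff)
    then show "y = z" using same[of \<delta> \<delta>' x x' \<gamma>] *(3,4) by metis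
  qed
  moreover have "M s \<inter> M t = {}" if "s \<noteq> t" for s t
  proof -
    have "s = t" if z: "z \<in> M s" "z \<in> M t" for z
    proof -
      obtain \<delta> x \<delta>' x' where "\<delta> \<in> \<Delta>" "\<delta>' \<in> \<Delta>" "x \<in> K" "x' \<in> K" "\<delta> x \<in> P" "\<delta>' x' \<in> P"
          "z = \<delta> (h x)" "z = \<delta>' (h x')" "sig F' (\<delta> x) = s" "sig F' (\<delta>' x') = t"
        using z unfolding M_iff by blast
      then show ?thesis using same[of \<delta> \<delta>' x x' id] SG(2) by (metis id_apply)
    qed
    then show ?thesis using that by blast
  qed
  moreover have "P \<inter> {z. sig F' z = s} \<noteq> {}" if "M s \<noteq> {}" for s
    using that by (force simp: M_iff)
  moreover have "P \<inter> {z. sig F' z = s} \<subseteq> P \<inter> {z. sig F z = s \<inter> F}" for s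
    using sig_restrict[OF F(3)] by auto
  moreover have "M s \<subseteq> P \<inter> {z. sig F z = s \<inter> F}" for s
  proof
    fix z assume "z \<in> M s"
    then obtain \<delta> x where *: "\<delta> \<in> \<Delta>" "x \<in> K" "z = \<delta> (h x)" "\<delta> x \<in> P" "sig F' (\<delta> x) = s"
      unfolding M_iff by blast
    have "sig F z = sig F (\<delta> x)" using eqv[OF F(1) *(1) match[OF *(2)]] * by simp
    then show "z \<in> P \<inter> {z. sig F z = s \<inter> F}"
      using P(3)[rule_format, of "\<delta> x" z] * sig_restrict[OF F(3)] by auto
  qed
  \<comment> \<open>Piece \<open>s\<close> is moved into the \<open>F'\<close>-atom \<open>s\<close>
    of \<open>P\<close>, which is nonempty since it contains the points \<open>\<delta> x\<close>
    themselves. The confining set depends only on \<open>s \<inter> F\<close>, so it is shared by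
    all \<open>F'\<close>-atoms inside one \<open>F\<close>-atom.\<close>
  ultimately have "\<exists>\<sigma>\<in>G. (\<forall>s\<in>Pow F'. \<sigma> ` M s \<subseteq> P \<inter> {z. sig F' z = s}) \<and>
    (\<forall>Z. (\<forall>s\<in>Pow F'. P \<inter> {z. sig F z = s \<inter> F} \<subseteq> Z \<or> (P \<inter> {z. sig F z = s \<inter> F}) \<inter> Z = {})
      \<longrightarrow> (\<forall>x. \<sigma> x \<in> Z \<longleftrightarrow> x \<in> Z))"
    using P(1) fin Mcl by (intro sparse_move_family[OF X G]) (auto intro!: clopen_sig)
  then obtain \<sigma> where \<sigma>: "\<sigma> \<in> G" "\<And>s. s \<subseteq> F' \<Longrightarrow> \<sigma> ` M s \<subseteq> P \<inter> {z. sig F' z = s}"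
    and \<sigma>Z: "\<And>Z x. (\<forall>s\<in>Pow F'. P \<inter> {z. sig F z = s \<inter> F} \<subseteq> Z \<or> (P \<inter> {z. sig F z = s \<inter> F}) \<inter> Z = {})
      \<Longrightarrow> \<sigma> x \<in> Z \<longleftrightarrow> x \<in> Z"
    by auto
  have \<sigma>sig: "sig F (\<sigma> x) = sig F x" for x
    unfolding sig_eq_iff
  proof
    fix U assume U: "U \<in> F"
    show "\<sigma> x \<in> U \<longleftrightarrow> x \<in> U"
    proof (rule \<sigma>Z, rule ballI)
      fix s
      have "z \<in> U \<longleftrightarrow> U \<in> s \<inter> F" if "sig F z = s \<inter> F" for z
        using that U by (auto simp: sig_def)
      then show "P \<inter> {z. sig F z = s \<inter> F} \<subseteq> U \<or> (P \<inter> {z. sig F z = s \<inter> F}) \<inter> U = {}" by blast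
    qed
  qed
  obtain \<nu> where \<nu>: "\<nu> \<in> Homeo" "\<And>\<delta> x. \<delta> \<in> \<Delta> \<Longrightarrow> \<nu> (\<delta> x) = \<delta> (\<nu> x)" "\<And>x. sig F (\<nu> x) = sig F x"
      "\<And>\<delta> x. \<delta> \<in> \<Delta> \<Longrightarrow> \<delta> x \<in> P \<Longrightarrow> \<nu> x = finv \<delta> (\<sigma> (\<delta> x))"
    by (rule equivariant_extension[OF \<Delta>(1,2) F(1) P SG(1)[OF \<sigma>(1)] \<sigma>sig]) blast
  have "\<nu> \<in> G"
  proof (rule fullD[OF G(1) \<nu>(1), of "(\<lambda>\<delta>. finv \<delta> \<circ> \<sigma> \<circ> \<delta>) ` \<Delta>"])
    show "(\<lambda>\<delta>. finv \<delta> \<circ> \<sigma> \<circ> \<delta>) ` \<Delta> \<subseteq> G"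
      using \<Delta>(3) \<sigma>(1) SG(3,4) by (auto intro!: SG(3,4))
    show "\<exists>\<gamma>\<in>(\<lambda>\<delta>. finv \<delta> \<circ> \<sigma> \<circ> \<delta>) ` \<Delta>. \<nu> x = \<gamma> x" for x
    proof -
      obtain \<delta> where "\<delta> \<in> \<Delta>" "\<delta> x \<in> P" using P(2) unfolding fundamental_domain_def by blast
      then show ?thesis using \<nu>(4) by (intro bexI[of _ "finv \<delta> \<circ> \<sigma> \<circ> \<delta>"]) auto
    qed
  qed (use \<Delta>(2) in simp)
  moreover have "sig F' (\<nu> (h x)) = sig F' x" if x: "x \<in> K" for x
  proof -
    obtain \<delta> where \<delta>: "\<delta> \<in> \<Delta>" "\<delta> x \<in> P" using P(2) unfolding fundamental_domain_def by blast
    have "\<delta> (h x) \<in> P" using P(3)[rule_format, of "\<delta> x"] eqv[OF F(1) \<delta>(1) match[OF x]] \<delta>(2) by simp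
    then have \<nu>x: "\<nu> (h x) = finv \<delta> (\<sigma> (\<delta> (h x)))" using \<nu>(4) \<delta>(1) by blast
    \<comment> \<open>The requirement is met at the representative in \<open>P\<close>; applying
      \<open>finv \<delta>\<close>, which permutes the atoms of \<open>F'\<close>, carries it back
      to \<open>x\<close>.\<close>
    have "\<delta> (h x) \<in> M (sig F' (\<delta> x))" using \<delta> x by (auto simp: M_iff)
    then have "sig F' (\<sigma> (\<delta> (h x))) = sig F' (\<delta> x)" using \<sigma>(2)[OF sig_subset] by blast
    then have "sig F' (finv \<delta> (\<sigma> (\<delta> (h x)))) = sig F' (finv \<delta> (\<delta> x))"
      by (rule eqv[OF F(2) S(4)[OF \<delta>(1)]])
    then show ?thesis using \<nu>x S(1)[OF \<delta>(1)] by simp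
  qed
  ultimately show thesis using that \<nu> by blast
qed

text \<open>Any two atoms of \<open>F\<close> in one \<open>\<Delta>'\<close>-orbit have to be
  linked by elements of \<open>G'\<close>. Each atom \<open>s\<close> is sent by
  \<open>\<gamma> s\<close> in \<open>\<Delta>'\<close> into a common domain \<open>P'\<close>, and
  \<open>\<mu> s\<close> in \<open>G'\<close> has the same image of \<open>s\<close>. A map
  \<open>g\<close> with \<open>\<mu> s \<circ> g = \<gamma> s\<close> on \<open>s\<close> turns
  transitions inside \<open>\<Delta>'\<close> into transitions inside \<open>G'\<close>. Imposing
  this only on a \<open>\<Delta>\<close>-domain and extending equivariantly leaves the action of
  \<open>\<Delta>\<close> unchanged.\<close>

lemma intertwining:
  assumes G: "subgroup G homeo_group" and G': "full_group G'"
    and same: "\<And>\<gamma> U. \<gamma> \<in> G \<Longrightarrow> clopen U \<Longrightarrow> \<exists>\<mu>\<in>G'. \<mu> ` U = \<gamma> ` U"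
    and \<Delta>: "subgroup \<Delta> homeo_group" "\<Delta> \<subseteq> \<Delta>'" "\<Delta> \<subseteq> G'"
    and \<Delta>': "subgroup \<Delta>' homeo_group" "finite \<Delta>'" "\<Delta>' \<subseteq> G"
    and F: "adapted \<Delta>' F"
  obtains g where "g \<in> Homeo" "\<And>\<delta> x. \<delta> \<in> \<Delta> \<Longrightarrow> g (\<delta> x) = \<delta> (g x)" "\<And>x. sig F (g x) = sig F x"
    "\<And>\<delta>. \<delta> \<in> \<Delta>' \<Longrightarrow> g \<circ> \<delta> \<circ> finv g \<in> G'" "\<And>U. clopen U \<Longrightarrow> \<exists>\<mu>\<in>G'. \<mu> ` U = g ` U"
proof -
  note SG = subgroup_homeoD[OF G]
  note SG' = subgroup_homeoD[OF full_subgroup[OF G']]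
  note S = subgroup_homeoD[OF \<Delta>(1)]
  note S' = subgroup_homeoD[OF \<Delta>'(1)]
  have fin: "finite F" "\<And>U. U \<in> F \<Longrightarrow> clopen U" using F by (auto simp: adapted_def)
  have fin\<Delta>: "finite \<Delta>" using \<Delta>(2) \<Delta>'(2) finite_subset by blast
  have F0: "adapted \<Delta> F" using F \<Delta>(2) by (rule adapted_subgroup)
  obtain P where P: "clopen P" "fundamental_domain \<Delta> P"
      "\<forall>x y. sig F x = sig F y \<longrightarrow> x \<in> P \<longrightarrow> y \<in> P"
    by (rule adapted_fundamental_domain[OF \<Delta>(1) fin\<Delta> F0]) blast
  obtain P' where P': "clopen P'" "fundamental_domain \<Delta>' P'"
      "\<forall>x y. sig F x = sig F y \<longrightarrow> x \<in> P' \<longrightarrow> y \<in> P'"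
    by (rule adapted_fundamental_domain[OF \<Delta>'(1,2) F]) blast
  \<comment> \<open>One element serves a whole atom, because \<open>\<Delta>'\<close> permutes atoms
    and \<open>P'\<close> is a union of them; an empty atom gets the identity.\<close>
  have "\<exists>\<gamma>\<in>\<Delta>'. \<forall>x. sig F x = s \<longrightarrow> \<gamma> x \<in> P'" for s
  proof (cases "\<exists>x. sig F x = s")
    case True
    then obtain x where x: "sig F x = s" by blast
    obtain \<gamma> where \<gamma>: "\<gamma> \<in> \<Delta>'" "\<gamma> x \<in> P'" using P'(2) unfolding fundamental_domain_def by blast
    have "\<gamma> y \<in> P'" if "sig F y = s" for y
      using P'(3)[rule_format, of "\<gamma> x" "\<gamma> y"] sig_equivariant[OF \<Delta>'(1) F \<gamma>(1), of x y] that x \<gamma>(2) by simp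
    then show ?thesis using \<gamma>(1) by blast
  next
    case False
    then show ?thesis using S'(2) by blast
  qed
  then obtain \<gamma> where \<gamma>: "\<And>s. \<gamma> s \<in> \<Delta>'" "\<And>s x. sig F x = s \<Longrightarrow> \<gamma> s x \<in> P'" by metis
  have "\<exists>\<mu>\<in>G'. \<mu> ` {x. sig F x = s} = \<gamma> s ` {x. sig F x = s}" for s
    using same[OF _ clopen_sig[OF fin]] \<gamma>(1) \<Delta>'(3) by blast
  then obtain \<mu> where \<mu>: "\<And>s. \<mu> s \<in> G'" "\<And>s. \<mu> s ` {x. sig F x = s} = \<gamma> s ` {x. sig F x = s}" by metis
  have hom: "\<gamma> s \<in> Homeo" "\<mu> s \<in> Homeo" for s using \<gamma>(1) \<mu>(1) S'(1) SG'(1) by auto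
  \<comment> \<open>On atom \<open>s\<close> this is
    \<open>finv (\<mu> s) \<circ> \<gamma> s\<close>, which maps the atom onto itself, so
    \<open>m\<close> preserves all atoms.\<close>
  define m where "m x = finv (\<mu> (sig F x)) (\<gamma> (sig F x) x)" for x
  have img: "(finv (\<mu> s) \<circ> \<gamma> s) ` {x. sig F x = s} = id ` {x. sig F x = s}" for s
  proof -
    have "(finv (\<mu> s) \<circ> \<gamma> s) ` {x. sig F x = s} = finv (\<mu> s) ` \<mu> s ` {x. sig F x = s}"
      using \<mu>(2) by (metis image_comp)
    also have "\<dots> = id ` {x. sig F x = s}" using hom by (simp add: image_image)
    finally show ?thesis .
  qed
  have m: "m \<in> Homeo" "sig F (m x) = sig F x" for x
    using atomwise_glue[OF fin Homeo_id, of "\<lambda>s. finv (\<mu> s) \<circ> \<gamma> s"] img hom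
    by (simp_all add: m_def[abs_def] Homeo_comp Homeo_inv)
  obtain g where g: "g \<in> Homeo" "\<And>\<delta> x. \<delta> \<in> \<Delta> \<Longrightarrow> g (\<delta> x) = \<delta> (g x)" "\<And>x. sig F (g x) = sig F x"
      "\<And>\<delta> x. \<delta> \<in> \<Delta> \<Longrightarrow> \<delta> x \<in> P \<Longrightarrow> g x = finv \<delta> (m (\<delta> x))"
    by (rule equivariant_extension[OF \<Delta>(1) fin\<Delta> F0 P m]) blast
  have g\<mu>: "\<mu> (sig F (\<delta> x)) (\<delta> (g x)) = \<gamma> (sig F (\<delta> x)) (\<delta> x)" if "\<delta> \<in> \<Delta>" "\<delta> x \<in> P" for \<delta> x
    using g(4)[OF that] S(1)[OF that(1)] hom by (simp add: m_def)
  \<comment> \<open>Choose \<open>a\<close>, \<open>b\<close> in \<open>\<Delta>\<close> with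
    \<open>a x\<close> and \<open>b (\<delta> x)\<close> in \<open>P\<close>, lying in atoms
    \<open>s\<close> and \<open>t\<close>. Then \<open>\<gamma> s (a x)\<close> and
    \<open>\<gamma> t (b (\<delta> x))\<close> are points of \<open>P'\<close> in one
    \<open>\<Delta>'\<close>-orbit, hence equal. Rewriting both through \<open>g\<close> gives
    \<open>\<mu> t (b (g (\<delta> x))) = \<mu> s (a (g x))\<close>. So the conjugate agrees at each
    point with one of the finitely many elements \<open>?c\<close> of \<open>G'\<close>.\<close>
  have "g \<circ> \<delta> \<circ> finv g \<in> G'" if \<delta>: "\<delta> \<in> \<Delta>'" for \<delta>
  proof -
    let ?c = "\<lambda>(a, b, s, t). finv b \<circ> finv (\<mu> t) \<circ> \<mu> s \<circ> a"
    let ?A = "?c ` (\<Delta> \<times> \<Delta> \<times> Pow F \<times> Pow F)"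
    have hf: "g \<circ> \<delta> \<circ> finv g \<in> Homeo" using g(1) S'(1)[OF \<delta>] by (simp add: Homeo_comp Homeo_inv)
    show ?thesis
    proof (rule fullD[OF G' hf, of ?A])
      show "finite ?A" using fin\<Delta> fin by simp
      show "?A \<subseteq> G'" using \<Delta>(3) \<mu>(1) by (auto intro!: SG'(3,4))
      fix y
      define x where "x = finv g y"
      have y: "g x = y" using g(1) by (simp add: x_def)
      obtain a where a: "a \<in> \<Delta>" "a x \<in> P" using P(2) unfolding fundamental_domain_def by blast
      obtain b where b: "b \<in> \<Delta>" "b (\<delta> x) \<in> P" using P(2) unfolding fundamental_domain_def by blast
      let ?s = "sig F (a x)" and ?t = "sig F (b (\<delta> x))"
      have ha: "a \<in> Homeo" "b \<in> Homeo" "\<delta> \<in> Homeo" using a b \<delta> S(1) S'(1) by auto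
      have "\<gamma> ?t \<circ> b \<circ> \<delta> \<circ> finv a \<circ> finv (\<gamma> ?s) \<in> \<Delta>'"
        using \<gamma>(1) a b \<delta> \<Delta>(2) by (intro S'(3,4)) auto
      moreover have "(\<gamma> ?t \<circ> b \<circ> \<delta> \<circ> finv a \<circ> finv (\<gamma> ?s)) (\<gamma> ?s (a x)) = \<gamma> ?t (b (\<delta> x))"
        using hom ha by simp
      ultimately have "\<gamma> ?t (b (\<delta> x)) = \<gamma> ?s (a x)"
        using P'(2) \<gamma>(2) unfolding fundamental_domain_def by metis
      then have "\<mu> ?t (b (g (\<delta> x))) = \<mu> ?s (a (g x))" using g\<mu>[OF a] g\<mu>[OF b] by simp
      then have "g (\<delta> x) = ?c (a, b, ?s, ?t) (g x)"
        using ha hom by (simp, metis Homeo_inv_f)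
      then have "(g \<circ> \<delta> \<circ> finv g) y = ?c (a, b, ?s, ?t) y" using y by (simp add: x_def)
      moreover have "?c (a, b, ?s, ?t) \<in> ?A" 
        using a b sig_subset[of F "a x"] sig_subset[of F "b (\<delta> x)"] by (intro imageI) auto
      ultimately show "\<exists>\<gamma>\<in>?A. (g \<circ> \<delta> \<circ> finv g) y = \<gamma> y" by (rule bexI)
    qed
  qed
  moreover have "\<exists>\<mu>\<in>G'. \<mu> ` U = g ` U" if "clopen U" for U
  proof (rule piecewise_transfer[OF G' _ same g(1) fin _ that])
    show "G \<subseteq> Homeo" using SG(1) by blast
    fix s
    \<comment> \<open>A single \<open>\<delta>\<close> brings the whole atom into \<open>P\<close>;
      there \<open>g\<close> is \<open>\<gamma> ?t \<circ> \<delta>\<close> in \<open>G\<close>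
      followed by \<open>finv \<delta> \<circ> finv (\<mu> ?t)\<close> in \<open>G'\<close>.\<close>
    show "\<exists>\<nu>\<in>G'. \<exists>\<gamma>\<in>G. \<forall>x. sig F x = s \<longrightarrow> g x = \<nu> (\<gamma> x)"
    proof (cases "\<exists>x. sig F x = s")
      case True
      then obtain x where x: "sig F x = s" by blast
      obtain \<delta> where \<delta>: "\<delta> \<in> \<Delta>" "\<delta> x \<in> P" using P(2) unfolding fundamental_domain_def by blast
      let ?t = "sig F (\<delta> x)"
      have "g y = (finv \<delta> \<circ> finv (\<mu> ?t)) ((\<gamma> ?t \<circ> \<delta>) y)" if "sig F y = s" for y
      proof -
        have sig: "sig F (\<delta> y) = ?t" using sig_equivariant[OF \<Delta>(1) F0 \<delta>(1), of y x] that x by simp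
        then have "\<delta> y \<in> P" using P(3) \<delta>(2) by metis
        then show ?thesis using g(4)[OF \<delta>(1), of y] sig by (simp add: m_def)
      qed
      moreover have "finv \<delta> \<circ> finv (\<mu> ?t) \<in> G'" using \<delta> \<Delta>(3) \<mu>(1) by (intro SG'(3,4)) auto
      moreover have "\<gamma> ?t \<circ> \<delta> \<in> G" using \<delta> \<Delta>(2) \<Delta>'(3) \<gamma>(1) by (intro SG(3)) auto
      ultimately show ?thesis by blast
    next
      case False
      then show ?thesis using SG(2) SG'(2) by blast
    qed
  qed
  ultimately show thesis using that g by blast
qed

text \<open>Around a fixed point of \<open>\<delta>\<close> take its clopen fixed-point set; around
  any other point take a clopen set that \<open>\<delta>\<close> moves off itself. Intersecting over
  \<open>\<Delta>\<close> and passing to a finite cover gives sets inside which an element of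
  \<open>\<Delta>\<close> can return a point only by fixing it. Adding all
  \<open>\<Delta>\<close>-translates makes the family invariant.\<close>

lemma adapted_exists:
  fixes \<Delta> :: "('a::topological_space \<Rightarrow> 'a) set"
  assumes X: "is_cantor_space (euclidean :: 'a topology)"
    and \<Delta>: "subgroup \<Delta> homeo_group" "finite \<Delta>" "\<And>\<delta>. \<delta> \<in> \<Delta> \<Longrightarrow> clopen {x. \<delta> x = x}"
    and F: "finite F" "\<And>U. U \<in> F \<Longrightarrow> clopen U"
  obtains F' where "F \<subseteq> F'" "adapted \<Delta> F'"
proof -
  note S = subgroup_homeoD[OF \<Delta>(1)]
  have "\<exists>W. clopen W \<and> x \<in> W \<and> (\<forall>y\<in>W. \<delta> y \<in> W \<longrightarrow> \<delta> y = y)" if \<delta>: "\<delta> \<in> \<Delta>" for \<delta> x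
  proof (cases "\<delta> x = x")
    case True
    then show ?thesis using \<Delta>(3)[OF \<delta>] by (intro exI[of _ "{x. \<delta> x = x}"]) auto
  next
    case False
    then obtain C where C: "clopen C" "x \<in> C" "\<delta> x \<notin> C" using clopen_points_eq[OF X, of x "\<delta> x"] by metis
    then have "clopen (C \<inter> \<delta> -` (- C))"
      using S(1)[OF \<delta>] by (intro clopen_basic(3,4) Homeo_clopen_vimage)
    then show ?thesis using C by (intro exI[of _ "C \<inter> \<delta> -` (- C)"]) auto
  qed
  then obtain W where W: "\<And>\<delta> x. \<delta> \<in> \<Delta> \<Longrightarrow> clopen (W \<delta> x)" "\<And>\<delta> x. \<delta> \<in> \<Delta> \<Longrightarrow> x \<in> W \<delta> x"
      "\<And>\<delta> x y. \<delta> \<in> \<Delta> \<Longrightarrow> y \<in> W \<delta> x \<Longrightarrow> \<delta> y \<in> W \<delta> x \<Longrightarrow> \<delta> y = y"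
    by metis
  define V where "V x = (\<Inter>\<delta>\<in>\<Delta>. W \<delta> x)" for x
  have V: "clopen (V x)" "x \<in> V x" for x using W \<Delta>(2) by (auto simp: V_def intro!: clopen_INT)
  obtain T where T: "finite T" "UNIV \<subseteq> (\<Union>x\<in>T. V x)"
    using compactE_image[OF cantor_compact[OF X closed_UNIV], of UNIV V] V
    by (metis UN_I clopen_def subsetI)
  define F' where "F' = (\<lambda>(\<delta>, U). \<delta> ` U) ` (\<Delta> \<times> (F \<union> V ` T))"
  have sub: "F \<union> V ` T \<subseteq> F'"
  proof
    fix U assume "U \<in> F \<union> V ` T"
    then show "U \<in> F'" unfolding F'_def using S(2) by (intro image_eqI[of _ _ "(id, U)"]) auto
  qed
  have "adapted \<Delta> F'"
    unfolding adapted_def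
  proof (intro conjI ballI allI impI)
    show "finite F'" using \<Delta>(2) F(1) T(1) by (simp add: F'_def)
    show "clopen U" if "U \<in> F'" for U using that F(2) V(1) S(1) by (auto simp: F'_def intro!: Homeo_clopen)
    show "\<delta> ` U \<in> F'" if \<delta>: "\<delta> \<in> \<Delta>" and U: "U \<in> F'" for \<delta> U
    proof -
      obtain \<epsilon> C where *: "\<epsilon> \<in> \<Delta>" "C \<in> F \<union> V ` T" "U = \<epsilon> ` C" using U by (auto simp: F'_def)
      have "\<delta> ` U = (\<delta> \<circ> \<epsilon>) ` C" using * by (simp add: image_comp)
      then show ?thesis unfolding F'_def using * S(3)[OF \<delta> *(1)]
        by (intro image_eqI[of _ _ "(\<delta> \<circ> \<epsilon>, C)"]) auto
    qed
    show "\<delta> x = x" if "\<delta> \<in> \<Delta>" "sig F' (\<delta> x) = sig F' x" for \<delta> x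
    proof -
      obtain t where t: "t \<in> T" "x \<in> V t" using T(2) by blast
      then have "\<delta> x \<in> V t" using that(2) sub by (auto simp: sig_eq_iff)
      then show ?thesis using W(3)[of \<delta> x t] t that(1) by (auto simp: V_def)
    qed
  qed
  then show thesis using that sub by blast
qed

section \<open>Back and forth\<close>

lemma conj_by_mem:
  assumes "g \<in> Homeo"
  shows "f \<in> conj_by g G \<longleftrightarrow> finv g \<circ> f \<circ> g \<in> G"
proof
  assume "f \<in> conj_by g G"
  then obtain \<gamma> where \<gamma>: "\<gamma> \<in> G" "f = g \<circ> \<gamma> \<circ> finv g" using assms by (auto simp: conj_by_eq)
  have "finv g \<circ> f \<circ> g = \<gamma>" using assms by (simp add: \<gamma>(2) fun_eq_iff)
  then show "finv g \<circ> f \<circ> g \<in> G" using \<gamma> by simp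
next
  assume *: "finv g \<circ> f \<circ> g \<in> G"
  have "f = g \<circ> (finv g \<circ> f \<circ> g) \<circ> finv g" using assms by (simp add: fun_eq_iff)
  then show "f \<in> conj_by g G" unfolding conj_by_eq[OF assms] using * by (rule image_eqI)
qed

lemma subgroup_conj_by:
  assumes g: "g \<in> Homeo" and G: "subgroup G homeo_group"
  shows "subgroup (conj_by g G) homeo_group"
  unfolding subgroup_homeo_iff
proof (intro conjI ballI subsetI)
  note S = subgroup_homeoD[OF G]
  show "id \<in> conj_by g G"
  proof -
    have "finv g \<circ> id \<circ> g = id" using g by (simp add: fun_eq_iff)
    then show ?thesis using S(2) by (simp add: conj_by_mem[OF g])
  qed
  show "f \<in> Homeo" if "f \<in> conj_by g G" for f
    using that g S(1) by (auto simp: conj_by_eq intro!: Homeo_comp Homeo_inv)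
  fix f assume f: "f \<in> conj_by g G"
  show "f \<circ> f' \<in> conj_by g G" if "f' \<in> conj_by g G" for f'
  proof -
    have "finv g \<circ> (f \<circ> f') \<circ> g = (finv g \<circ> f \<circ> g) \<circ> (finv g \<circ> f' \<circ> g)" using g by (simp add: fun_eq_iff)
    then show ?thesis using S(3) f that by (simp add: conj_by_mem[OF g])
  qed
  obtain \<gamma> where \<gamma>: "\<gamma> \<in> G" "f = g \<circ> \<gamma> \<circ> finv g" using f g by (auto simp: conj_by_eq)
  have "finv f = g \<circ> finv \<gamma> \<circ> finv g"
    using g S(1)[OF \<gamma>(1)] by (simp add: \<gamma>(2) Homeo_inv_comp Homeo_comp Homeo_inv o_assoc)
  then show "finv f \<in> conj_by g G" using S(4)[OF \<gamma>(1)] g by (auto simp: conj_by_eq)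
qed

lemma full_conj_by:
  assumes g: "g \<in> Homeo" and G: "full_group G"
  shows "full_group (conj_by g G)"
  unfolding full_group_def
proof (intro conjI ballI impI)
  show "subgroup (conj_by g G) homeo_group" by (rule subgroup_conj_by[OF g full_subgroup[OF G]])
  fix f assume f: "f \<in> Homeo" and "\<exists>A. finite A \<and> A \<subseteq> conj_by g G \<and> (\<forall>x. \<exists>\<gamma>\<in>A. f x = \<gamma> x)"
  then obtain A where A: "finite A" "A \<subseteq> conj_by g G" "\<And>x. \<exists>\<gamma>\<in>A. f x = \<gamma> x" by blast
  have "finv g \<circ> f \<circ> g \<in> G"
  proof (rule fullD[OF G, of _ "(\<lambda>a. finv g \<circ> a \<circ> g) ` A"])
    show "finv g \<circ> f \<circ> g \<in> Homeo" using f g by (simp add: Homeo_comp Homeo_inv)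
    show "(\<lambda>a. finv g \<circ> a \<circ> g) ` A \<subseteq> G" using A(2) by (auto simp: conj_by_mem[OF g] subset_iff)
    show "\<exists>\<gamma>\<in>(\<lambda>a. finv g \<circ> a \<circ> g) ` A. (finv g \<circ> f \<circ> g) x = \<gamma> x" for x
      using A(3)[of "g x"] by auto
  qed (use A(1) in simp)
  then show "f \<in> conj_by g G" by (simp add: conj_by_mem[OF g])
qed

lemma acts_minimallyI:
  assumes "\<And>x V. open V \<Longrightarrow> V \<noteq> {} \<Longrightarrow> \<exists>\<gamma>\<in>G. \<gamma> x \<in> V"
  shows "acts_minimally G"
  unfolding acts_minimally_def
proof (intro allI, rule ccontr)
  fix x assume "closure (orb G x) \<noteq> UNIV"
  then obtain \<gamma> where "\<gamma> \<in> G" "\<gamma> x \<in> - closure (orb G x)"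
    using assms[of "- closure (orb G x)" x] by auto
  then show False using closure_subset[of "orb G x"] orb_mem[of \<gamma> G x] by auto
qed

lemma minimal_conj_by:
  fixes g :: "'a::topological_space \<Rightarrow> 'a"
  assumes g: "g \<in> Homeo" and G: "acts_minimally G"
  shows "acts_minimally (conj_by g G)"
proof (rule acts_minimallyI)
  fix x and V :: "'a set" assume V: "open V" "V \<noteq> {}"
  obtain v where "v \<in> V" using V(2) by blast
  then have "finv g v \<in> g -` V" using g by simp
  then obtain \<gamma> where "\<gamma> \<in> G" "\<gamma> (finv g x) \<in> g -` V"
    using minimal_orbit_meets[OF G Homeo_open_vimage[OF g V(1)], of "finv g x"] by blast
  then show "\<exists>\<gamma>\<in>conj_by g G. \<gamma> x \<in> V"
    using g by (intro bexI[of _ "g \<circ> \<gamma> \<circ> finv g"]) (auto simp: conj_by_eq)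
qed

lemma sparse_conj_by:
  assumes g: "g \<in> Homeo" and G: "subgroup G homeo_group" and L: "orbit_sparse G L"
  shows "orbit_sparse (conj_by g G) (g ` L)"
proof (rule orbit_sparseI[OF subgroup_conj_by[OF g G]])
  show "closed (g ` L)" using Homeo_closed[OF g] orbit_sparse_closed[OF L] by blast
  fix x y \<gamma> assume *: "x \<in> g ` L" "y \<in> g ` L" "\<gamma> \<in> conj_by g G" "\<gamma> x = y"
  then obtain u v where uv: "u \<in> L" "v \<in> L" "x = g u" "y = g v" by blast
  have "(finv g \<circ> \<gamma> \<circ> g) u = v" using uv * g by simp
  moreover have "finv g \<circ> \<gamma> \<circ> g \<in> G" using *(3) by (simp add: conj_by_mem[OF g])
  ultimately show "x = y" using orbit_sparseD[OF L G uv(1,2), of "finv g \<circ> \<gamma> \<circ> g"] uv by simp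
qed

lemma homeomorphism_comp_Homeo:
  assumes g: "g \<in> Homeo" and h: "homeomorphism K L h h'"
  shows "homeomorphism K (g ` L) (g \<circ> h) (h' \<circ> finv g)"
proof (rule homeomorphism_compose[OF h])
  show "homeomorphism L (g ` L) g (finv g)"
    using g by (auto simp: homeomorphism_def Homeo_iff image_image bij_is_inj intro: continuous_on_subset)
qed

text \<open>The condition on \<open>K\<close> is the matching of \<open>h\<close> with
  \<open>g\<close>, stated atom by atom in the source. The last clause is what remains of the
  isomorphism of closures; \<open>g\<close> itself changes from stage to stage, so the clause has to
  be carried along for the next extension to find elements with prescribed images.\<close>

definition stage ::
    "('a::topological_space \<Rightarrow> 'a) set \<Rightarrow> ('a \<Rightarrow> 'a) set \<Rightarrow> 'a set \<Rightarrow> ('a \<Rightarrow> 'a) \<Rightarrow>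
     ('a \<Rightarrow> 'a) \<Rightarrow> ('a \<Rightarrow> 'a) set \<Rightarrow> 'a set set \<Rightarrow> bool" where
  "stage \<Gamma> \<Lambda> K h g \<Delta> F \<longleftrightarrow> g \<in> Homeo \<and> subgroup \<Delta> homeo_group \<and> finite \<Delta> \<and> \<Delta> \<subseteq> \<Gamma> \<and>
     conj_by g \<Delta> \<subseteq> \<Lambda> \<and> adapted \<Delta> F \<and> (\<forall>x\<in>K. sig F (finv g (h x)) = sig F x) \<and>
     (\<forall>U V. clopen U \<longrightarrow> clopen V \<longrightarrow>
       (\<exists>\<gamma>\<in>\<Gamma>. \<gamma> ` U = V) = (\<exists>\<nu>\<in>\<Lambda>. \<nu> ` (g ` U) = g ` V))"

lemma stageD:
  assumes "stage \<Gamma> \<Lambda> K h g \<Delta> F"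
  shows "g \<in> Homeo" "subgroup \<Delta> homeo_group" "finite \<Delta>" "\<Delta> \<subseteq> \<Gamma>" "conj_by g \<Delta> \<subseteq> \<Lambda>" "adapted \<Delta> F"
    "\<And>x. x \<in> K \<Longrightarrow> sig F (finv g (h x)) = sig F x"
    "\<And>U V. clopen U \<Longrightarrow> clopen V \<Longrightarrow>
       (\<exists>\<gamma>\<in>\<Gamma>. \<gamma> ` U = V) = (\<exists>\<nu>\<in>\<Lambda>. \<nu> ` (g ` U) = g ` V)"
  using assms unfolding stage_def by simp_all

definition extends ::
    "('a \<Rightarrow> 'a) \<Rightarrow> ('a \<Rightarrow> 'a) set \<Rightarrow> 'a set set \<Rightarrow> ('a \<Rightarrow> 'a) \<Rightarrow> ('a \<Rightarrow> 'a) set \<Rightarrow> 'a set set \<Rightarrow> bool" where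
  "extends g \<Delta> F g' \<Delta>' F' \<longleftrightarrow> \<Delta> \<subseteq> \<Delta>' \<and> F \<subseteq> F' \<and> (\<forall>U\<in>F. g' ` U = g ` U) \<and>
     (\<forall>\<delta>\<in>\<Delta>. g' \<circ> \<delta> \<circ> finv g' = g \<circ> \<delta> \<circ> finv g)"

lemma extends_refl: "extends g \<Delta> F g \<Delta> F"
  by (simp add: extends_def)

lemma extends_trans:
  assumes "extends g \<Delta> F g' \<Delta>' F'" "extends g' \<Delta>' F' g'' \<Delta>'' F''"
  shows "extends g \<Delta> F g'' \<Delta>'' F''"
  using assms unfolding extends_def by (metis subset_iff)

text \<open>The case where the current homeomorphism is the identity. The new one is
  \<open>finv \<nu> \<circ> f\<close>, with \<open>\<nu>\<close> correcting \<open>h\<close> and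
  \<open>f\<close> conjugating \<open>\<Delta>'\<close>. Its inverse sends \<open>h x\<close> to
  \<open>finv f (\<nu> (h x))\<close>, and \<open>f\<close> preserves the atoms of
  \<open>F'\<close>, so the match obtained by \<open>\<nu>\<close> survives.\<close>

lemma extension_normalized:
  fixes \<Gamma> \<Lambda> :: "('a::topological_space \<Rightarrow> 'a) set"
  assumes X: "is_cantor_space (euclidean :: 'a topology)"
    and \<Gamma>: "subgroup \<Gamma> homeo_group" and \<Lambda>: "full_group \<Lambda>" "acts_minimally \<Lambda>"
    and same: "\<And>\<gamma> U. \<gamma> \<in> \<Gamma> \<Longrightarrow> clopen U \<Longrightarrow> \<exists>\<nu>\<in>\<Lambda>. \<nu> ` U = \<gamma> ` U"
    and \<Delta>: "subgroup \<Delta> homeo_group" "\<Delta> \<subseteq> \<Delta>'" "\<Delta> \<subseteq> \<Lambda>"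
    and \<Delta>': "subgroup \<Delta>' homeo_group" "finite \<Delta>'" "\<Delta>' \<subseteq> \<Gamma>"
    and F: "adapted \<Delta> F" "adapted \<Delta>' F'" "F \<subseteq> F'"
    and L: "orbit_sparse \<Lambda> L" and h: "homeomorphism K L h h'"
    and match: "\<And>x. x \<in> K \<Longrightarrow> sig F (h x) = sig F x"
  obtains g where "g \<in> Homeo" "\<And>\<delta> x. \<delta> \<in> \<Delta> \<Longrightarrow> g (\<delta> x) = \<delta> (g x)" "\<And>x. sig F (g x) = sig F x"
    "conj_by g \<Delta>' \<subseteq> \<Lambda>" "\<And>U. clopen U \<Longrightarrow> \<exists>\<nu>\<in>\<Lambda>. \<nu> ` U = g ` U"
    "\<And>x. x \<in> K \<Longrightarrow> sig F' (finv g (h x)) = sig F' x"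
proof -
  note S\<Lambda> = subgroup_homeoD[OF full_subgroup[OF \<Lambda>(1)]]
  have fin: "finite \<Delta>" using \<Delta>(2) \<Delta>'(2) finite_subset by blast
  obtain \<nu> where \<nu>: "\<nu> \<in> \<Lambda>" "\<And>\<delta> x. \<delta> \<in> \<Delta> \<Longrightarrow> \<nu> (\<delta> x) = \<delta> (\<nu> x)" "\<And>x. sig F (\<nu> x) = sig F x"
      "\<And>x. x \<in> K \<Longrightarrow> sig F' (\<nu> (h x)) = sig F' x"
    by (rule sparse_adjustment[OF X \<Lambda> \<Delta>(1) fin \<Delta>(3) F(1) adapted_subgroup[OF F(2) \<Delta>(2)] F(3) L h match])
      blast+
  obtain f where f: "f \<in> Homeo" "\<And>\<delta> x. \<delta> \<in> \<Delta> \<Longrightarrow> f (\<delta> x) = \<delta> (f x)" "\<And>x. sig F' (f x) = sig F' x"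
      "\<And>\<delta>. \<delta> \<in> \<Delta>' \<Longrightarrow> f \<circ> \<delta> \<circ> finv f \<in> \<Lambda>" "\<And>U. clopen U \<Longrightarrow> \<exists>\<mu>\<in>\<Lambda>. \<mu> ` U = f ` U"
    by (rule intertwining[OF \<Gamma> \<Lambda>(1) same \<Delta> \<Delta>' F(2)]) blast+
  have hom: "\<nu> \<in> Homeo" using \<nu>(1) by (rule S\<Lambda>(1))
  let ?g = "finv \<nu> \<circ> f"
  show thesis
  proof (rule that[of ?g])
    show g: "?g \<in> Homeo" using f(1) hom by (simp add: Homeo_comp Homeo_inv)
    show "?g (\<delta> x) = \<delta> (?g x)" if "\<delta> \<in> \<Delta>" for \<delta> x
      using \<nu>(2)[OF that, of "finv \<nu> (f x)"] f(2)[OF that] hom by (simp, metis Homeo_inv_f)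
    show "sig F (?g x) = sig F x" for x
      using \<nu>(3)[of "?g x"] hom sig_mono[OF F(3) f(3)] by simp
    show "conj_by ?g \<Delta>' \<subseteq> \<Lambda>"
    proof
      fix l assume "l \<in> conj_by ?g \<Delta>'"
      then obtain \<delta> where \<delta>: "\<delta> \<in> \<Delta>'" "l = ?g \<circ> \<delta> \<circ> finv ?g" using g by (auto simp: conj_by_eq)
      have "l = finv \<nu> \<circ> (f \<circ> \<delta> \<circ> finv f) \<circ> \<nu>"
        using hom f(1) by (simp add: \<delta>(2) Homeo_inv_comp Homeo_inv o_assoc)
      then show "l \<in> \<Lambda>" using f(4)[OF \<delta>(1)] \<nu>(1) by (simp only: S\<Lambda>)
    qed
    show "\<exists>\<mu>\<in>\<Lambda>. \<mu> ` U = ?g ` U" if U: "clopen U" for U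
    proof -
      obtain \<mu> where "\<mu> \<in> \<Lambda>" "\<mu> ` U = f ` U" using f(5)[OF U] by blast
      then have "(finv \<nu> \<circ> \<mu>) ` U = ?g ` U" "finv \<nu> \<circ> \<mu> \<in> \<Lambda>"
        using \<nu>(1) by (simp_all only: S\<Lambda> image_comp[symmetric])
      then show ?thesis by blast
    qed
    show "sig F' (finv ?g (h x)) = sig F' x" if "x \<in> K" for x
      using \<nu>(4)[OF that] f(3)[of "finv f (\<nu> (h x))"] hom f(1) by (simp add: Homeo_inv_comp Homeo_inv)
  qed
qed

text \<open>Replacing \<open>\<Lambda>\<close> by
  \<open>\<Lambda>0 = conj_by (finv g) \<Lambda>\<close> and \<open>h\<close> by
  \<open>finv g \<circ> h\<close> turns the current homeomorphism into the identity; the resulting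
  \<open>f\<close> is then composed with \<open>g\<close>.\<close>

lemma stage_forward:
  fixes \<Gamma> \<Lambda> :: "('a::topological_space \<Rightarrow> 'a) set"
  assumes X: "is_cantor_space (euclidean :: 'a topology)"
    and \<Gamma>: "ample \<Gamma>" and \<Lambda>: "full_group \<Lambda>" "acts_minimally \<Lambda>"
    and L: "orbit_sparse \<Lambda> L" and h: "homeomorphism K L h h'"
    and st: "stage \<Gamma> \<Lambda> K h g \<Delta> F" and \<gamma>: "\<gamma> \<in> \<Gamma>" and U: "clopen U"
  obtains g' \<Delta>' F' where "stage \<Gamma> \<Lambda> K h g' \<Delta>' F'" "extends g \<Delta> F g' \<Delta>' F'" "\<gamma> \<in> \<Delta>'" "U \<in> F'"
proof -
  note st = stageD[OF st]
  have \<Gamma>': "subgroup \<Gamma> homeo_group" "locally_finite_group \<Gamma>" "\<And>\<gamma>. \<gamma> \<in> \<Gamma> \<Longrightarrow> clopen {x. \<gamma> x = x}"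
    using \<Gamma> by (auto simp: ample_def full_group_def clopen_def)
  note S\<Lambda> = subgroup_homeoD[OF full_subgroup[OF \<Lambda>(1)]]
  note SG = subgroup_homeoD[OF \<Gamma>'(1)]
  define \<Delta>' where "\<Delta>' = generate homeo_group (insert \<gamma> \<Delta>)"
  have sub: "insert \<gamma> \<Delta> \<subseteq> \<Gamma>" using \<gamma> st(4) by blast
  then have "insert \<gamma> \<Delta> \<subseteq> Homeo" using SG(1) by blast
  then have \<Delta>': "subgroup \<Delta>' homeo_group"
    unfolding \<Delta>'_def by (rule group.generate_is_subgroup[OF group_homeo_group])
  have \<Delta>'\<Gamma>: "\<Delta>' \<subseteq> \<Gamma>" unfolding \<Delta>'_def
    by (rule group.generate_subgroup_incl[OF group_homeo_group sub \<Gamma>'(1)])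
  \<comment> \<open>Local finiteness keeps the enlarged group finite, so that adapted families and
    fundamental domains exist for it.\<close>
  have fin: "finite \<Delta>'" using \<Gamma>'(2) sub st(3) unfolding locally_finite_group_def \<Delta>'_def by simp
  have in\<Delta>': "\<gamma> \<in> \<Delta>'" "\<Delta> \<subseteq> \<Delta>'" unfolding \<Delta>'_def by (auto intro: generate.incl)
  have Ffin: "finite (insert U F)" "\<And>V. V \<in> insert U F \<Longrightarrow> clopen V"
    using st(6) U by (auto simp: adapted_def)
  obtain F' where F': "insert U F \<subseteq> F'" "adapted \<Delta>' F'"
    using adapted_exists[OF X \<Delta>' fin \<Gamma>'(3) Ffin] \<Delta>'\<Gamma> by blast
  define \<Lambda>0 where "\<Lambda>0 = conj_by (finv g) \<Lambda>"
  have g: "g \<in> Homeo" "finv g \<in> Homeo" using st(1) Homeo_inv by auto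
  have mem0: "f \<in> \<Lambda>0 \<longleftrightarrow> g \<circ> f \<circ> finv g \<in> \<Lambda>" for f
    unfolding \<Lambda>0_def conj_by_mem[OF g(2)] using g by simp
  have \<Lambda>0: "full_group \<Lambda>0" "acts_minimally \<Lambda>0" "orbit_sparse \<Lambda>0 (finv g ` L)"
    unfolding \<Lambda>0_def
    using full_conj_by[OF g(2) \<Lambda>(1)] minimal_conj_by[OF g(2) \<Lambda>(2)]
      sparse_conj_by[OF g(2) full_subgroup[OF \<Lambda>(1)] L] by auto
  have same: "\<exists>\<nu>\<in>\<Lambda>0. \<nu> ` V = \<gamma> ` V" if \<gamma>: "\<gamma> \<in> \<Gamma>" and V: "clopen V" for \<gamma> V
  proof -
    have "\<exists>\<gamma>'\<in>\<Gamma>. \<gamma>' ` V = \<gamma> ` V" using \<gamma> by (rule bexI[rotated]) (rule refl)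
    then obtain \<nu> where \<nu>: "\<nu> \<in> \<Lambda>" "\<nu> ` (g ` V) = g ` (\<gamma> ` V)"
      unfolding st(8)[OF V Homeo_clopen[OF SG(1)[OF \<gamma>] V]] by (elim bexE)
    have "(finv g \<circ> \<nu> \<circ> g) ` V = finv g ` (\<nu> ` (g ` V))" by (simp add: image_image)
    also have "\<dots> = finv g ` (g ` (\<gamma> ` V))" by (simp only: \<nu>(2))
    also have "\<dots> = \<gamma> ` V" using g(1) by (simp add: image_image)
    finally have "(finv g \<circ> \<nu> \<circ> g) ` V = \<gamma> ` V" .
    moreover have "g \<circ> (finv g \<circ> \<nu> \<circ> g) \<circ> finv g = \<nu>" using g(1) by (simp add: fun_eq_iff)
    ultimately show ?thesis using \<nu>(1) mem0 by metis
  qed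
  have \<Delta>\<Lambda>0: "\<Delta> \<subseteq> \<Lambda>0" using st(5) g(1) by (auto simp: mem0 conj_by_eq)
  have match: "sig F ((finv g \<circ> h) x) = sig F x" if "x \<in> K" for x using st(7)[OF that] by simp
  obtain f where f: "f \<in> Homeo" "\<And>\<delta> x. \<delta> \<in> \<Delta> \<Longrightarrow> f (\<delta> x) = \<delta> (f x)" "\<And>x. sig F (f x) = sig F x"
      "conj_by f \<Delta>' \<subseteq> \<Lambda>0" "\<And>U. clopen U \<Longrightarrow> \<exists>\<nu>\<in>\<Lambda>0. \<nu> ` U = f ` U"
      "\<And>x. x \<in> K \<Longrightarrow> sig F' (finv f ((finv g \<circ> h) x)) = sig F' x"
    by (rule extension_normalized[OF X \<Gamma>'(1) \<Lambda>0(1,2) same st(2) in\<Delta>'(2) \<Delta>\<Lambda>0 \<Delta>' fin \<Delta>'\<Gamma> st(6) F'(2) _ \<Lambda>0(3)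
          homeomorphism_comp_Homeo[OF g(2) h] match]) (use F'(1) in blast)+
  let ?g = "g \<circ> f"
  have g': "?g \<in> Homeo" using g f(1) by (simp add: Homeo_comp)
  \<comment> \<open>For each clopen \<open>V\<close> the sets \<open>g(V)\<close> and
    \<open>?g(V)\<close> are equivalent under \<open>\<Lambda>\<close>; hence the last clause of
    \<open>stage\<close> passes from \<open>g\<close> to \<open>?g\<close>.\<close>
  have moved: "\<exists>\<nu>\<in>\<Lambda>. \<nu> ` (g ` V) = ?g ` V" if V: "clopen V" for V
  proof -
    obtain \<nu> where \<nu>: "\<nu> \<in> \<Lambda>0" "\<nu> ` V = f ` V" using f(5)[OF V] by blast
    have "(g \<circ> \<nu> \<circ> finv g) ` (g ` V) = g ` \<nu> ` V" using g(1) by (simp add: image_image)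
    also have "\<dots> = ?g ` V" by (simp only: \<nu>(2) image_comp)
    finally show ?thesis using \<nu>(1) mem0 by blast
  qed
  have "stage \<Gamma> \<Lambda> K h ?g \<Delta>' F'"
    unfolding stage_def
  proof (intro conjI g' \<Delta>' fin \<Delta>'\<Gamma> F'(2) ballI allI impI)
    show "conj_by ?g \<Delta>' \<subseteq> \<Lambda>"
    proof
      fix l assume "l \<in> conj_by ?g \<Delta>'"
      then obtain \<delta> where \<delta>: "\<delta> \<in> \<Delta>'" "l = ?g \<circ> \<delta> \<circ> finv ?g" using g' by (auto simp: conj_by_eq)
      have "f \<circ> \<delta> \<circ> finv f \<in> \<Lambda>0" using f(1,4) \<delta>(1) by (auto simp: conj_by_eq)
      moreover have "l = g \<circ> (f \<circ> \<delta> \<circ> finv f) \<circ> finv g"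
        using g(1) f(1) by (simp add: \<delta>(2) Homeo_inv_comp o_assoc)
      ultimately show "l \<in> \<Lambda>" using mem0 by simp
    qed
    show "sig F' (finv ?g (h x)) = sig F' x" if "x \<in> K" for x
      using f(6)[OF that] g(1) f(1) by (simp add: Homeo_inv_comp)
    fix V W :: "'a set" assume VW: "clopen V" "clopen W"
    obtain a where a: "a \<in> \<Lambda>" "a ` (g ` V) = ?g ` V" using moved[OF VW(1)] by blast
    obtain b where b: "b \<in> \<Lambda>" "b ` (g ` W) = ?g ` W" using moved[OF VW(2)] by blast
    have ab: "a \<in> Homeo" "b \<in> Homeo" using a b S\<Lambda>(1) by auto
    have a': "finv a ` (?g ` V) = g ` V" unfolding a(2)[symmetric] using ab by (simp add: image_image)
    have b': "finv b ` (?g ` W) = g ` W" unfolding b(2)[symmetric] using ab by (simp add: image_image)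
    have "(\<exists>\<nu>\<in>\<Lambda>. \<nu> ` (g ` V) = g ` W) = (\<exists>\<nu>\<in>\<Lambda>. \<nu> ` (?g ` V) = ?g ` W)"
    proof
      assume "\<exists>\<nu>\<in>\<Lambda>. \<nu> ` (g ` V) = g ` W"
      then obtain \<nu> where \<nu>: "\<nu> \<in> \<Lambda>" "\<nu> ` (g ` V) = g ` W" by blast
      have "b \<circ> \<nu> \<circ> finv a \<in> \<Lambda>" using \<nu>(1) a(1) b(1) by (simp add: S\<Lambda>)
      moreover have "(b \<circ> \<nu> \<circ> finv a) ` (?g ` V) = ?g ` W"
        using \<nu>(2) a' b(2) by (metis image_comp)
      ultimately show "\<exists>\<nu>\<in>\<Lambda>. \<nu> ` (?g ` V) = ?g ` W" by blast
    next
      assume "\<exists>\<nu>\<in>\<Lambda>. \<nu> ` (?g ` V) = ?g ` W"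
      then obtain \<nu> where \<nu>: "\<nu> \<in> \<Lambda>" "\<nu> ` (?g ` V) = ?g ` W" by blast
      have "finv b \<circ> \<nu> \<circ> a \<in> \<Lambda>" using \<nu>(1) a(1) b(1) by (simp add: S\<Lambda>)
      moreover have "(finv b \<circ> \<nu> \<circ> a) ` (g ` V) = g ` W"
        using \<nu>(2) a(2) b' by (metis image_comp)
      ultimately show "\<exists>\<nu>\<in>\<Lambda>. \<nu> ` (g ` V) = g ` W" by blast
    qed
    then show "(\<exists>\<gamma>\<in>\<Gamma>. \<gamma> ` V = W) = (\<exists>\<nu>\<in>\<Lambda>. \<nu> ` (?g ` V) = ?g ` W)" using st(8)[OF VW] by simp
  qed
  moreover have "extends g \<Delta> F ?g \<Delta>' F'"
    unfolding extends_def
  proof (intro conjI ballI)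
    show "\<Delta> \<subseteq> \<Delta>'" by (rule in\<Delta>'(2))
    show "F \<subseteq> F'" using F'(1) by blast
    show "?g ` V = g ` V" if "V \<in> F" for V
    proof -
      have "f x \<in> V \<longleftrightarrow> x \<in> V" for x using f(3)[of x] that by (simp add: sig_eq_iff)
      then have "f ` V = V" using f(1) by (metis Homeo_f_inv Homeo_mem_image subsetI subset_antisym)
      then show ?thesis by (metis image_comp)
    qed
    show "?g \<circ> \<delta> \<circ> finv ?g = g \<circ> \<delta> \<circ> finv g" if "\<delta> \<in> \<Delta>" for \<delta>
      using f(2)[OF that] g(1) f(1) by (simp add: Homeo_inv_comp fun_eq_iff)
  qed
  ultimately show thesis using that in\<Delta>'(1) F'(1) by blast
qed

text \<open>The notion of stage is symmetric under inversion, so the backward half of the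
  construction is the forward half with \<open>\<Gamma>\<close> and \<open>\<Lambda>\<close>
  exchanged.\<close>

lemma stage_inverse:
  assumes h: "homeomorphism K L h h'" and st: "stage \<Gamma> \<Lambda> K h g \<Delta> F"
  shows "stage \<Lambda> \<Gamma> L h' (finv g) (conj_by g \<Delta>) ((`) g ` F)"
proof -
  note st = stageD[OF st]
  have g: "g \<in> Homeo" "finv g \<in> Homeo" using st(1) Homeo_inv by auto
  note S = subgroup_homeoD[OF st(2)]
  have sig: "sig ((`) g ` F) x = sig ((`) g ` F) y \<longleftrightarrow> sig F (finv g x) = sig F (finv g y)" for x y
    using g(1) by (simp add: sig_eq_iff Homeo_mem_image)
  have inv: "conj_by (finv g) (conj_by g \<Delta>) = \<Delta>"
  proof (rule Set.set_eqI)
    fix f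
    have "finv g \<circ> (g \<circ> f \<circ> finv g) \<circ> g = f" using g(1) by (simp add: fun_eq_iff)
    then show "f \<in> conj_by (finv g) (conj_by g \<Delta>) \<longleftrightarrow> f \<in> \<Delta>"
      using g by (simp add: conj_by_mem)
  qed
  show ?thesis
    unfolding stage_def
  proof (intro conjI g(2) subgroup_conj_by[OF g(1) st(2)] st(5) ballI allI impI)
    show "finite (conj_by g \<Delta>)" using st(3) g(1) by (simp add: conj_by_eq)
    show "conj_by (finv g) (conj_by g \<Delta>) \<subseteq> \<Gamma>" using inv st(4) by simp
    show "adapted (conj_by g \<Delta>) ((`) g ` F)"
      unfolding adapted_def
    proof (intro conjI ballI allI impI)
      show "finite ((`) g ` F)" using st(6) by (simp add: adapted_def)
      show "clopen U" if "U \<in> (`) g ` F" for U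
        using that st(6) Homeo_clopen[OF g(1)] by (auto simp: adapted_def)
      fix \<delta> assume "\<delta> \<in> conj_by g \<Delta>"
      then obtain \<epsilon> where \<epsilon>: "\<epsilon> \<in> \<Delta>" "\<delta> = g \<circ> \<epsilon> \<circ> finv g" using g(1) by (auto simp: conj_by_eq)
      show "\<delta> ` U \<in> (`) g ` F" if U: "U \<in> (`) g ` F" for U
      proof -
        obtain V where V: "V \<in> F" "U = g ` V" using U by blast
        then have "\<delta> ` U = g ` (\<epsilon> ` V)" using g(1) by (simp add: \<epsilon>(2) image_image)
        moreover have "\<epsilon> ` V \<in> F" using st(6) \<epsilon>(1) V(1) by (simp add: adapted_def)
        ultimately show ?thesis by blast
      qed
      show "\<delta> x = x" if "sig ((`) g ` F) (\<delta> x) = sig ((`) g ` F) x" for x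
      proof -
        have "sig F (\<epsilon> (finv g x)) = sig F (finv g x)" using that g(1) unfolding sig by (simp add: \<epsilon>(2))
        then have "\<epsilon> (finv g x) = finv g x" using st(6) \<epsilon>(1) by (simp add: adapted_def)
        then show ?thesis using g(1) by (simp add: \<epsilon>(2))
      qed
    qed
    show "sig ((`) g ` F) (finv (finv g) (h' y)) = sig ((`) g ` F) y" if "y \<in> L" for y
    proof -
      have "h' y \<in> K" "h (h' y) = y" using h that by (auto simp: homeomorphism_def)
      then show ?thesis using st(7)[of "h' y"] g(1) unfolding sig by simp
    qed
    fix U V :: "'a set" assume UV: "clopen U" "clopen V"
    have "g ` finv g ` U = U" "g ` finv g ` V = V" using g(1) by (simp_all add: image_image)
    then show "(\<exists>\<gamma>\<in>\<Lambda>. \<gamma> ` U = V) = (\<exists>\<nu>\<in>\<Gamma>. \<nu> ` (finv g ` U) = finv g ` V)"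
      using st(8)[OF Homeo_clopen[OF g(2) UV(1)] Homeo_clopen[OF g(2) UV(2)]] by simp
  qed
qed

text \<open>Extend forward, invert, extend forward again, invert. The first extension takes in
  \<open>\<gamma>\<close> and \<open>U\<close>, the second takes in \<open>\<nu>\<close> and the
  preimage of \<open>U\<close>.\<close>

lemma stage_step:
  fixes \<Gamma> \<Lambda> :: "('a::topological_space \<Rightarrow> 'a) set"
  assumes X: "is_cantor_space (euclidean :: 'a topology)"
    and ample: "ample \<Gamma>" "ample \<Lambda>" and minimal: "acts_minimally \<Gamma>" "acts_minimally \<Lambda>"
    and sparse: "orbit_sparse \<Gamma> K" "orbit_sparse \<Lambda> L" and h: "homeomorphism K L h h'"
    and st: "stage \<Gamma> \<Lambda> K h g \<Delta> F" and \<gamma>: "\<gamma> \<in> \<Gamma>" and \<nu>: "\<nu> \<in> \<Lambda>" and U: "clopen U"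
  shows "\<exists>g' \<Delta>' F'. stage \<Gamma> \<Lambda> K h g' \<Delta>' F' \<and> extends g \<Delta> F g' \<Delta>' F' \<and>
    \<gamma> \<in> \<Delta>' \<and> \<nu> \<in> conj_by g' \<Delta>' \<and> U \<in> F' \<and> finv g' ` U \<in> F'"
proof -
  have full: "full_group \<Gamma>" "full_group \<Lambda>" using ample by (auto simp: ample_def)
  obtain g1 \<Delta>1 F1 where st1: "stage \<Gamma> \<Lambda> K h g1 \<Delta>1 F1" "extends g \<Delta> F g1 \<Delta>1 F1" "\<gamma> \<in> \<Delta>1" "U \<in> F1"
    by (rule stage_forward[OF X ample(1) full(2) minimal(2) sparse(2) h st \<gamma> U])
  obtain g2 \<Delta>2 F2 where st2: "stage \<Lambda> \<Gamma> L h' g2 \<Delta>2 F2"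
      "extends (finv g1) (conj_by g1 \<Delta>1) ((`) g1 ` F1) g2 \<Delta>2 F2" "\<nu> \<in> \<Delta>2" "U \<in> F2"
    by (rule stage_forward[OF X ample(2) full(1) minimal(1) sparse(1) homeomorphism_symD[OF h]
          stage_inverse[OF h st1(1)] \<nu> U])
  have g: "g1 \<in> Homeo" "g2 \<in> Homeo" "finv g2 \<in> Homeo"
    using stageD(1)[OF st1(1)] stageD(1)[OF st2(1)] Homeo_inv by auto
  have sets: "g2 ` g1 ` W = W" if "W \<in> F1" for W
  proof -
    have "g2 ` (g1 ` W) = finv g1 ` (g1 ` W)" using st2(2) that unfolding extends_def by blast
    also have "\<dots> = W" using g(1) by (simp add: image_image)
    finally show ?thesis .
  qed
  have maps: "g2 \<circ> (g1 \<circ> \<delta> \<circ> finv g1) \<circ> finv g2 = \<delta>" if "\<delta> \<in> \<Delta>1" for \<delta>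
  proof -
    have "g1 \<circ> \<delta> \<circ> finv g1 \<in> conj_by g1 \<Delta>1" using that g(1) by (simp add: conj_by_eq)
    then have "g2 \<circ> (g1 \<circ> \<delta> \<circ> finv g1) \<circ> finv g2 = finv g1 \<circ> (g1 \<circ> \<delta> \<circ> finv g1) \<circ> finv (finv g1)"
      using st2(2) unfolding extends_def by blast
    then show ?thesis using g(1) by (simp add: fun_eq_iff)
  qed
  let ?g = "finv g2" and ?\<Delta> = "conj_by g2 \<Delta>2" and ?F = "(`) g2 ` F2"
  have "extends g1 \<Delta>1 F1 ?g ?\<Delta> ?F"
    unfolding extends_def
  proof (intro conjI ballI subsetI)
    show "\<delta> \<in> ?\<Delta>" if "\<delta> \<in> \<Delta>1" for \<delta>
    proof -
      have "g1 \<circ> \<delta> \<circ> finv g1 \<in> \<Delta>2" using st2(2) that g(1) by (auto simp: extends_def conj_by_eq)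
      then have "g2 \<circ> (g1 \<circ> \<delta> \<circ> finv g1) \<circ> finv g2 \<in> ?\<Delta>" using g(2) by (simp add: conj_by_eq)
      then show ?thesis by (simp only: maps[OF that])
    qed
    fix W assume W: "W \<in> F1"
    have "g1 ` W \<in> F2" using st2(2) W by (auto simp: extends_def)
    then show "W \<in> ?F" using sets[OF W] by blast
    have "?g ` W = finv g2 ` g2 ` g1 ` W" by (simp only: sets[OF W])
    then show "?g ` W = g1 ` W" using g(2) by (simp add: image_image)
  next
    fix \<delta> assume \<delta>: "\<delta> \<in> \<Delta>1"
    have "?g \<circ> \<delta> \<circ> finv ?g = finv g2 \<circ> (g2 \<circ> (g1 \<circ> \<delta> \<circ> finv g1) \<circ> finv g2) \<circ> g2"
      using g(2) by (simp only: maps[OF \<delta>] Homeo_inv_inv)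
    then show "?g \<circ> \<delta> \<circ> finv ?g = g1 \<circ> \<delta> \<circ> finv g1" using g(2) by (simp add: fun_eq_iff)
  qed
  then have ext: "extends g \<Delta> F ?g ?\<Delta> ?F" "extends g1 \<Delta>1 F1 ?g ?\<Delta> ?F"
    using extends_trans[OF st1(2)] by auto
  have "stage \<Gamma> \<Lambda> K h ?g ?\<Delta> ?F" by (rule stage_inverse[OF homeomorphism_symD[OF h] st2(1)])
  moreover have "\<gamma> \<in> ?\<Delta>" "U \<in> ?F" using ext(2) st1(3,4) unfolding extends_def by blast+
  \<comment> \<open>The new homeomorphism is \<open>finv g2\<close>, so the preimage of
    \<open>U\<close> is \<open>g2(U)\<close>, a member of \<open>?F\<close> because \<open>U\<close>
    was put into \<open>F2\<close>.\<close>
  moreover have "finv ?g ` U \<in> ?F" using st2(4) g(2) by simp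
  moreover have "\<nu> \<in> conj_by ?g ?\<Delta>"
  proof -
    have "finv g2 \<circ> (g2 \<circ> \<nu> \<circ> finv g2) \<circ> g2 = \<nu>" using g(2) by (simp add: fun_eq_iff)
    then show ?thesis using st2(3) g by (simp add: conj_by_mem)
  qed
  ultimately show ?thesis using ext(1) by blast
qed

section \<open>Limits of homeomorphisms that stabilize on clopen sets\<close>

lemma clopen_coordinates:
  fixes U :: "'a::topological_space set" and \<phi> :: "'a \<Rightarrow> nat \<Rightarrow> bool"
  assumes "compact (UNIV :: 'a set)" "\<And>k. clopen {x. \<phi> x k}"
    and nb: "\<forall>U x. open U \<longrightarrow> x \<in> U \<longrightarrow> (\<exists>n. \<forall>y. (\<forall>k<n. \<phi> y k = \<phi> x k) \<longrightarrow> y \<in> U)"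
    and U: "clopen U"
  shows "\<exists>n. \<forall>x y. (\<forall>k<n. \<phi> x k = \<phi> y k) \<longrightarrow> (x \<in> U \<longleftrightarrow> y \<in> U)"
proof -
  have "\<exists>n. \<forall>y. (\<forall>k<n. \<phi> y k = \<phi> x k) \<longrightarrow> (y \<in> U \<longleftrightarrow> x \<in> U)" for x
    using nb[rule_format, of U x] nb[rule_format, of "- U" x] U by (cases "x \<in> U") (auto simp: clopen_def)
  then obtain n where n: "\<And>x y. (\<forall>k<n x. \<phi> y k = \<phi> x k) \<Longrightarrow> y \<in> U \<longleftrightarrow> x \<in> U" by metis
  define C where "C x = {y. \<forall>k<n x. \<phi> y k = \<phi> x k}" for x
  have op: "open (C x)" for x
  proof -
    have "C x = (\<Inter>k\<in>{..<n x}. if \<phi> x k then {y. \<phi> y k} else - {y. \<phi> y k})"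
      by (auto simp: C_def split: if_splits)
    also have "clopen \<dots>" using assms(2) by (intro clopen_INT) auto
    finally show ?thesis by (simp add: clopen_def)
  qed
  have cov: "UNIV \<subseteq> (\<Union>x\<in>UNIV. C x)" by (auto simp: C_def)
  obtain T where T: "finite T" "UNIV \<subseteq> (\<Union>x\<in>T. C x)"
    by (rule compactE_image[OF assms(1) op cov])
  \<comment> \<open>Finitely many cylinders \<open>C t\<close> cover the space, so the largest of
    their lengths serves every point.\<close>
  have "x \<in> U \<longleftrightarrow> y \<in> U" if *: "\<forall>k<Max (n ` T). \<phi> x k = \<phi> y k" for x y
  proof -
    obtain t where t: "t \<in> T" "x \<in> C t" using T(2) by blast
    have "n t \<le> Max (n ` T)" using t(1) T(1) by simp
    then have "y \<in> C t" using t(2) * by (auto simp: C_def)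
    then show ?thesis using n[of t x] n[of t y] t(2) by (simp add: C_def)
  qed
  then show ?thesis by blast
qed

text \<open>The k-th bit of \<open>G x\<close> is the eventual value of the k-th bit of
  \<open>f n x\<close>. A clopen set depends on finitely many bits, so its preimage under
  \<open>G\<close> is eventually that under \<open>f n\<close>.\<close>

lemma pointwise_limit:
  fixes f :: "nat \<Rightarrow> 'a::topological_space \<Rightarrow> 'a"
  assumes X: "is_cantor_space (euclidean :: 'a topology)"
    and ev: "\<And>U. clopen U \<Longrightarrow> \<exists>N. \<forall>n\<ge>N. f n -` U = f N -` U"
  obtains G where "\<And>U. clopen U \<Longrightarrow> \<exists>N. \<forall>n\<ge>N. G -` U = f n -` U"
proof -
  obtain \<phi> :: "'a \<Rightarrow> nat \<Rightarrow> bool" and \<psi> where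
    \<phi>: "\<And>x. \<psi> (\<phi> x) = x" "\<And>p. \<phi> (\<psi> p) = p" "\<And>k. clopen {x. \<phi> x k}"
    "\<And>U x. open U \<Longrightarrow> x \<in> U \<Longrightarrow> \<exists>n. \<forall>y. (\<forall>k<n. \<phi> y k = \<phi> x k) \<longrightarrow> y \<in> U" "compact (UNIV :: 'a set)"
    by (rule cantor_embedding[OF X]) blast
  obtain N where N: "\<And>k n. n \<ge> N k \<Longrightarrow> f n -` {x. \<phi> x k} = f (N k) -` {x. \<phi> x k}"
    using ev[OF \<phi>(3)] by metis
  define G where "G x = \<psi> (\<lambda>k. \<phi> (f (N k) x) k)" for x
  have G: "\<phi> (G x) k = \<phi> (f n x) k" if "n \<ge> N k" for x k n
    using N[OF that] by (auto simp: G_def \<phi>(2))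
  show thesis
  proof
    fix U :: "'a set" assume "clopen U"
    have nb: "\<forall>U x. open U \<longrightarrow> x \<in> U \<longrightarrow> (\<exists>n. \<forall>y. (\<forall>k<n. \<phi> y k = \<phi> x k) \<longrightarrow> y \<in> U)"
      using \<phi>(4) by blast
    obtain m where m: "\<forall>x y. (\<forall>k<m. \<phi> x k = \<phi> y k) \<longrightarrow> (x \<in> U \<longleftrightarrow> y \<in> U)"
      using clopen_coordinates[OF \<phi>(5,3) nb \<open>clopen U\<close>] by (elim exE)
    have "G x \<in> U \<longleftrightarrow> f n x \<in> U" if "n \<ge> Max (N ` {..<m})" for n x
    proof (rule m[rule_format])
      fix k assume "k < m"
      then have "N k \<le> Max (N ` {..<m})" by simp
      then show "\<phi> (G x) k = \<phi> (f n x) k" using G[OF order_trans] that by blast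
    qed
    then show "\<exists>N. \<forall>n\<ge>N. G -` U = f n -` U" by blast
  qed
qed

text \<open>Stabilizing images are stabilizing preimages of the inverses, so the inverses have a
  limit \<open>H\<close> as well, and \<open>H\<close> inverts \<open>G\<close>.\<close>

lemma Homeo_limit:
  fixes f :: "nat \<Rightarrow> 'a::topological_space \<Rightarrow> 'a"
  assumes X: "is_cantor_space (euclidean :: 'a topology)" and f: "\<And>n. f n \<in> Homeo"
    and ev: "\<And>U. clopen U \<Longrightarrow> \<exists>N. \<forall>n\<ge>N. f n ` U = f N ` U"
      "\<And>U. clopen U \<Longrightarrow> \<exists>N. \<forall>n\<ge>N. f n -` U = f N -` U"
  obtains G where "G \<in> Homeo" "\<And>U. clopen U \<Longrightarrow> \<exists>N. \<forall>n\<ge>N. G -` U = f n -` U"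
proof -
  obtain G where G: "\<And>U. clopen U \<Longrightarrow> \<exists>N. \<forall>n\<ge>N. G -` U = f n -` U"
    by (rule pointwise_limit[OF X ev(2)]) blast+
  have ev': "\<exists>N. \<forall>n\<ge>N. finv (f n) -` U = finv (f N) -` U" if "clopen U" for U
    using ev(1)[OF that] f by (simp add: Homeo_image_vimage)
  obtain H where H: "\<And>U. clopen U \<Longrightarrow> \<exists>N. \<forall>n\<ge>N. H -` U = finv (f n) -` U"
    by (rule pointwise_limit[OF X ev']) blast+
  \<comment> \<open>The preimage of \<open>U\<close> under \<open>H\<close> equals its preimage
    under \<open>finv (f n)\<close> for large \<open>n\<close>, hence is clopen; at an index late
    enough for both sets, \<open>H \<circ> G\<close> can be tested with
    \<open>finv (f n) \<circ> f n\<close>.\<close>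
  have HG: "H (G x) = x" for x
  proof (rule clopen_points_eq[OF X, symmetric])
    fix U assume U: "clopen U" "x \<in> U"
    obtain N1 where N1: "\<And>n. n \<ge> N1 \<Longrightarrow> H -` U = finv (f n) -` U" using H[OF U(1)] by blast
    have cl: "clopen (H -` U)" using N1[of N1] Homeo_clopen_vimage[OF Homeo_inv[OF f] U(1)] by simp
    obtain N2 where N2: "\<And>n. n \<ge> N2 \<Longrightarrow> G -` (H -` U) = f n -` (H -` U)" using G[OF cl] by blast
    have "x \<in> f (max N1 N2) -` (H -` U)" using N1[of "max N1 N2"] f U(2) by simp
    then show "H (G x) \<in> U" using N2[of "max N1 N2"] by auto
  qed
  have GH: "G (H x) = x" for x
  proof (rule clopen_points_eq[OF X, symmetric])
    fix U assume U: "clopen U" "x \<in> U"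
    obtain N1 where N1: "\<And>n. n \<ge> N1 \<Longrightarrow> G -` U = f n -` U" using G[OF U(1)] by blast
    have cl: "clopen (G -` U)" using N1[of N1] Homeo_clopen_vimage[OF f U(1)] by simp
    obtain N2 where N2: "\<And>n. n \<ge> N2 \<Longrightarrow> H -` (G -` U) = finv (f n) -` (G -` U)" using H[OF cl] by blast
    have "x \<in> finv (f (max N1 N2)) -` (G -` U)" using N1[of "max N1 N2"] f U(2) by simp
    then show "G (H x) \<in> U" using N2[of "max N1 N2"] by auto
  qed
  have cont: "continuous_on UNIV A"
    if A: "\<And>U. clopen U \<Longrightarrow> clopen (A -` U)" for A :: "'a \<Rightarrow> 'a"
    unfolding continuous_on_open_vimage[OF open_UNIV]
  proof (intro allI impI)
    fix B :: "'a set" assume B: "open B"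
    show "open (A -` B \<inter> UNIV)"
    proof (subst open_subopen, intro ballI)
      fix x assume "x \<in> A -` B \<inter> UNIV"
      then obtain W where W: "clopen W" "A x \<in> W" "W \<subseteq> B" using clopen_base[OF X B, of "A x"] by auto
      then show "\<exists>T. open T \<and> x \<in> T \<and> T \<subseteq> A -` B \<inter> UNIV"
        using A[OF W(1)] by (intro exI[of _ "A -` W"]) (auto simp: clopen_def)
    qed
  qed
  have "clopen (G -` U)" if "clopen U" for U
    using G[OF that] Homeo_clopen_vimage[OF f that] by (metis order_refl)
  moreover have "clopen (H -` U)" if "clopen U" for U
    using H[OF that] Homeo_clopen_vimage[OF Homeo_inv[OF f] that] by (metis order_refl)
  ultimately have "homeomorphism UNIV UNIV G H"
    using HG GH cont by (auto simp: homeomorphism_def) (metis rangeI)+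
  then have "G \<in> Homeo" by (auto simp: homeo_group_def)
  then show thesis using that G by blast
qed

text \<open>The maps sending \<open>U\<close> into \<open>f(U)\<close> and the complement of
  \<open>U\<close> into the complement of \<open>f(U)\<close> form a neighbourhood of
  \<open>f\<close> in the compact-open topology, and for a bijection the two inclusions force
  equality on \<open>U\<close>.\<close>

lemma closure_transport:
  fixes G :: "('a::topological_space \<Rightarrow> 'a) set"
  assumes X: "is_cantor_space (euclidean :: 'a topology)"
    and f: "f \<in> homeo_topology closure_of G" and U: "clopen U"
  shows "\<exists>\<gamma>\<in>G. \<gamma> ` U = f ` U"
proof -
  have f_Homeo: "f \<in> Homeo" using f by (metis closure_of_subset_topspace subsetD topspace_homeo_topology)
  have sub: "openin homeo_topology {g \<in> Homeo. g ` C \<subseteq> V}" if "compact C" "open V" for C V :: "'a set"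
    unfolding homeo_topology_def by (rule topology_generated_by_Basis) (use that in blast)
  have cpt: "compact U" "compact (- U)"
    using cantor_compact[OF X] U by (auto simp: clopen_def closed_Compl)
  have op: "open (f ` U)" "open (f ` (- U))"
    using Homeo_open[OF f_Homeo] U by (auto simp: clopen_def open_Compl)
  let ?N = "{g \<in> Homeo. g ` U \<subseteq> f ` U} \<inter> {g \<in> Homeo. g ` (- U) \<subseteq> f ` (- U)}"
  have "openin homeo_topology ?N" using sub[OF cpt(1) op(1)] sub[OF cpt(2) op(2)] by (rule openin_Int)
  moreover have "f \<in> ?N" using f_Homeo by blast
  moreover have "\<forall>T. f \<in> T \<and> openin homeo_topology T \<longrightarrow> (\<exists>\<gamma>. \<gamma> \<in> G \<and> \<gamma> \<in> T)"
    using f by (simp add: in_closure_of)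
  ultimately have "\<exists>\<gamma>. \<gamma> \<in> G \<and> \<gamma> \<in> ?N" by (metis (no_types, lifting))
  then obtain \<gamma> where \<gamma>: "\<gamma> \<in> G" "\<gamma> \<in> ?N" by (elim exE conjE)
  have "f ` U \<subseteq> \<gamma> ` U"
  proof
    fix y assume y: "y \<in> f ` U"
    show "y \<in> \<gamma> ` U"
    proof (rule ccontr)
      assume "y \<notin> \<gamma> ` U"
      then have "y \<in> \<gamma> ` (- U)" using \<gamma>(2) by (simp add: Homeo_mem_image)
      then have "y \<in> f ` (- U)" using \<gamma>(2) by blast
      then show False using y f_Homeo by (simp add: Homeo_mem_image)
    qed
  qed
  then show ?thesis using \<gamma> by blast
qed

text \<open>For the trivial group and the empty family there is a single atom, so the match with
  \<open>h\<close> is vacuous. The content is the clause on clopen sets, obtained by approximating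
  elements of either closure.\<close>

lemma initial_stage:
  fixes \<Gamma> \<Lambda> :: "('a::topological_space \<Rightarrow> 'a) set"
  assumes X: "is_cantor_space (euclidean :: 'a topology)"
    and \<Gamma>: "subgroup \<Gamma> homeo_group" and \<Lambda>: "subgroup \<Lambda> homeo_group"
    and iso: "isomorphic_closures \<Gamma> \<Lambda>"
  obtains g where "stage \<Gamma> \<Lambda> K h g {id} {}"
proof -
  obtain g where g: "g \<in> Homeo"
    and cl: "conj_by g (homeo_topology closure_of \<Gamma>) = homeo_topology closure_of \<Lambda>"
    using iso by (auto simp: isomorphic_closures_def)
  note S = subgroup_homeoD[OF \<Gamma>] and S' = subgroup_homeoD[OF \<Lambda>]
  have sub: "\<Gamma> \<subseteq> homeo_topology closure_of \<Gamma>" "\<Lambda> \<subseteq> homeo_topology closure_of \<Lambda>"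
    using S(1) S'(1) by (auto intro!: closure_of_subset[THEN subsetD] simp: topspace_homeo_topology)
  have "(\<exists>\<gamma>\<in>\<Gamma>. \<gamma> ` U = V) = (\<exists>\<nu>\<in>\<Lambda>. \<nu> ` (g ` U) = g ` V)" if U: "clopen U" for U V
  proof
    assume "\<exists>\<gamma>\<in>\<Gamma>. \<gamma> ` U = V"
    then obtain \<gamma> where \<gamma>: "\<gamma> \<in> \<Gamma>" "\<gamma> ` U = V" by blast
    have "g \<circ> \<gamma> \<circ> finv g \<in> homeo_topology closure_of \<Lambda>"
      unfolding cl[symmetric] using sub(1) \<gamma>(1) g by (auto simp: conj_by_eq)
    then obtain \<nu> where "\<nu> \<in> \<Lambda>" "\<nu> ` (g ` U) = (g \<circ> \<gamma> \<circ> finv g) ` (g ` U)"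
      using closure_transport[OF X _ Homeo_clopen[OF g U]] by blast
    moreover have "(g \<circ> \<gamma> \<circ> finv g) ` (g ` U) = g ` V" using g \<gamma>(2) by (auto simp: image_image)
    ultimately show "\<exists>\<nu>\<in>\<Lambda>. \<nu> ` (g ` U) = g ` V" by auto
  next
    assume "\<exists>\<nu>\<in>\<Lambda>. \<nu> ` (g ` U) = g ` V"
    then obtain \<nu> where \<nu>: "\<nu> \<in> \<Lambda>" "\<nu> ` (g ` U) = g ` V" by blast
    have "finv g \<circ> \<nu> \<circ> g \<in> homeo_topology closure_of \<Gamma>"
      using sub(2) \<nu>(1) cl conj_by_mem[OF g] by blast
    then obtain \<gamma> where \<gamma>: "\<gamma> \<in> \<Gamma>" "\<gamma> ` U = (finv g \<circ> \<nu> \<circ> g) ` U"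
      using closure_transport[OF X _ U] by blast
    have "(finv g \<circ> \<nu> \<circ> g) ` U = finv g ` (\<nu> ` (g ` U))" by (simp add: image_image)
    also have "\<dots> = finv g ` (g ` V)" by (simp only: \<nu>(2))
    also have "\<dots> = V" using g by (simp add: image_image)
    finally show "\<exists>\<gamma>\<in>\<Gamma>. \<gamma> ` U = V" using \<gamma> by auto
  qed
  moreover have "conj_by g {id} = {id}" using g by (simp add: conj_by_eq fun_eq_iff)
  moreover have "subgroup {id} homeo_group"
    using Homeo_id by (simp add: subgroup_homeo_iff)
  ultimately have "stage \<Gamma> \<Lambda> K h g {id} {}"
    using g S(2) S'(2) by (simp add: stage_def adapted_def sig_def)
  then show thesis by (rule that)
qed

section \<open>The limit homeomorphism\<close>

theorem theorem3p11:
  fixes \<Gamma> \<Lambda> :: "('a::topological_space \<Rightarrow> 'a) set"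
    and K L :: "'a set" and h h' :: "'a \<Rightarrow> 'a"
  assumes "is_cantor_space (euclidean :: 'a topology)"
    and "ample \<Gamma>" and "ample \<Lambda>"
    and "acts_minimally \<Gamma>" and "acts_minimally \<Lambda>"
    and "isomorphic_closures \<Gamma> \<Lambda>"
    and "closed K" and "closed L"
    and "orbit_sparse \<Gamma> K" and "orbit_sparse \<Lambda> L"
    and "homeomorphism K L h h'"
  shows "\<exists>g\<in>Homeo. conj_by g \<Gamma> = \<Lambda> \<and> (\<forall>x\<in>K. g x = h x)"
proof -
  note X = assms(1)
  have \<Gamma>: "subgroup \<Gamma> homeo_group" "countable \<Gamma>" and \<Lambda>: "subgroup \<Lambda> homeo_group" "countable \<Lambda>"
    using assms(2,3) by (auto simp: ample_def full_group_def)
  note S = subgroup_homeoD[OF \<Gamma>(1)] and S' = subgroup_homeoD[OF \<Lambda>(1)]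
  \<comment> \<open>Each task combines an element of either group with a clopen set. Every triple
    occurs in the enumeration, and one occurrence suffices because whatever enters a stage
    stays.\<close>
  define task where "task = from_nat_into (\<Gamma> \<times> \<Lambda> \<times> {U :: 'a set. clopen U})"
  have ne: "\<Gamma> \<times> \<Lambda> \<times> {U :: 'a set. clopen U} \<noteq> {}" using S(2) S'(2) clopen_basic(1) by blast
  have task: "fst (task n) \<in> \<Gamma>" "fst (snd (task n)) \<in> \<Lambda>" "clopen (snd (snd (task n)))" for n
    using from_nat_into[OF ne, of n] by (auto simp: task_def mem_Times_iff)
  have "countable (\<Gamma> \<times> \<Lambda> \<times> {U :: 'a set. clopen U})"
    using \<Gamma>(2) \<Lambda>(2) countable_clopen[OF X] by (intro countable_SIGMA) auto
  then have task_surj: "\<exists>n. task n = (\<gamma>, \<nu>, U)" if "\<gamma> \<in> \<Gamma>" "\<nu> \<in> \<Lambda>" "clopen U" for \<gamma> \<nu> and U :: "'a set"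
    using from_nat_into_surj[of "\<Gamma> \<times> \<Lambda> \<times> {U :: 'a set. clopen U}" "(\<gamma>, \<nu>, U)"] that
    by (auto simp: task_def)
  let ?st = "\<lambda>(g, \<Delta>, F). stage \<Gamma> \<Lambda> K h g \<Delta> F"
  let ?step = "\<lambda>(\<gamma>, \<nu>, U) (g, \<Delta>, F) (g', \<Delta>', F'). extends g \<Delta> F g' \<Delta>' F' \<and>
    \<gamma> \<in> \<Delta>' \<and> \<nu> \<in> conj_by g' \<Delta>' \<and> U \<in> F' \<and> finv g' ` U \<in> F'"
  have "\<exists>s. \<forall>n. ?st (s n) \<and> ?step (task n) (s n) (s (Suc n))"
  proof (rule dependent_nat_choice)
    obtain g where "stage \<Gamma> \<Lambda> K h g {id} {}" by (rule initial_stage[OF X \<Gamma>(1) \<Lambda>(1) assms(6)])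
    then show "\<exists>x. ?st x" by (intro exI[of _ "(g, {id}, {})"]) simp
    fix x n assume x: "?st x"
    obtain g \<Delta> F where x_eq: "x = (g, \<Delta>, F)" by (cases x)
    obtain \<gamma> \<nu> U where t_eq: "task n = (\<gamma>, \<nu>, U)" by (cases "task n")
    show "\<exists>y. ?st y \<and> ?step (task n) x y"
      using stage_step[OF X assms(2-5,9-11), of g \<Delta> F \<gamma> \<nu> U] x task[of n] unfolding x_eq t_eq by auto
  qed
  then obtain s where s_conj: "\<forall>n. ?st (s n) \<and> ?step (task n) (s n) (s (Suc n))" by (elim exE)
  have s: "?st (s n)" "?step (task n) (s n) (s (Suc n))" for n
    using spec[OF s_conj, of n] by (rule conjunct1, rule conjunct2)
  define g \<Delta> F where "g n = fst (s n)" and "\<Delta> n = fst (snd (s n))" and "F n = snd (snd (s n))" for n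
  have s_eq: "s n = (g n, \<Delta> n, F n)" for n by (simp add: g_def \<Delta>_def F_def)
  have st: "stage \<Gamma> \<Lambda> K h (g n) (\<Delta> n) (F n)" for n using s(1)[of n] by (simp add: s_eq)
  note st = stageD[OF st]
  have Suc_ext: "extends (g n) (\<Delta> n) (F n) (g (Suc n)) (\<Delta> (Suc n)) (F (Suc n))" for n
    using s(2)[of n] by (cases "task n") (simp add: s_eq)
  have ext: "extends (g n) (\<Delta> n) (F n) (g m) (\<Delta> m) (F m)" if "n \<le> m" for n m
    using that by (induction m rule: dec_induct) (auto intro: extends_refl extends_trans Suc_ext)
  have reach: "\<exists>n. \<gamma> \<in> \<Delta> n \<and> \<nu> \<in> conj_by (g n) (\<Delta> n) \<and> U \<in> F n \<and> finv (g n) ` U \<in> F n"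
    if *: "\<gamma> \<in> \<Gamma>" "\<nu> \<in> \<Lambda>" "clopen U" for \<gamma> \<nu> U
  proof -
    obtain n where n: "task n = (\<gamma>, \<nu>, U)" using task_surj[OF *] by blast
    show ?thesis by (rule exI[of _ "Suc n"]) (use s(2)[of n] n in \<open>simp add: s_eq\<close>)
  qed
  have setsD: "g m ` U = g n ` U" "U \<in> F m" if "U \<in> F n" "n \<le> m" for n m U
    using ext[OF that(2)] that(1) by (auto simp: extends_def)
  have image_cancel: "g n ` finv (g n) ` U = U" "finv (g n) ` g n ` U = U" for n U
    using st(1)[of n] by (simp_all add: image_image)
  have ev1: "\<exists>N. \<forall>n\<ge>N. g n ` U = g N ` U" if U: "clopen U" for U
  proof -
    obtain N where "U \<in> F N" using reach[OF S(2) S'(2) U] by (elim exE conjE)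
    then show ?thesis by (intro exI[of _ N] allI impI setsD(1))
  qed
  have preimages: "\<exists>N. \<forall>n\<ge>N. finv (g n) ` U = finv (g N) ` U \<and> finv (g n) ` U \<in> F n" if U: "clopen U" for U
  proof -
    obtain N where N: "finv (g N) ` U \<in> F N" using reach[OF S(2) S'(2) U] by (elim exE conjE)
    \<comment> \<open>From stage \<open>N\<close> on the set \<open>finv (g N) (U)\<close> is
      frozen: every later \<open>g n\<close> maps it onto \<open>U\<close>, so it is also the
      preimage of \<open>U\<close> under \<open>g n\<close>.\<close>
    have eq: "finv (g n) ` U = finv (g N) ` U" if "n \<ge> N" for n
      using setsD(1)[OF N that] image_cancel by metis
    have mem: "finv (g n) ` U \<in> F n" if "n \<ge> N" for n
      using setsD(2)[OF N that] eq[OF that] by metis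
    show ?thesis by (intro exI[of _ N] allI impI conjI eq mem)
  qed
  have ev2: "\<exists>N. \<forall>n\<ge>N. g n -` U = g N -` U" if U: "clopen U" for U
  proof -
    have eq: "g n -` U = finv (g n) ` U" for n
      using Homeo_image_vimage[OF Homeo_inv[OF st(1)[of n]], of U] st(1)[of n] by simp
    obtain N where N: "\<forall>n\<ge>N. finv (g n) ` U = finv (g N) ` U \<and> finv (g n) ` U \<in> F n"
      using preimages[OF U] by (elim exE)
    show ?thesis
    proof (intro exI[of _ N] allI impI)
      fix n assume "N \<le> n"
      then show "g n -` U = g N -` U" unfolding eq using N by blast
    qed
  qed
  obtain G where G: "G \<in> Homeo" "\<And>U. clopen U \<Longrightarrow> \<exists>N. \<forall>n\<ge>N. G -` U = g n -` U"
    by (rule Homeo_limit[OF X st(1) ev1 ev2]) blast+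
  \<comment> \<open>The conjugate \<open>l\<close> of \<open>\<delta>\<close> is the same for all
    stages \<open>m \<ge> n\<close>, so \<open>g m \<circ> \<delta> = l \<circ> g m\<close>. Tested
    against a clopen \<open>U\<close>, this passes to \<open>G\<close> at an index beyond
    \<open>n\<close> and beyond the stabilization of both \<open>U\<close> and its preimage under
    \<open>l\<close>.\<close>
  have limit: "G \<circ> \<delta> \<circ> finv G = g n \<circ> \<delta> \<circ> finv (g n)" if \<delta>: "\<delta> \<in> \<Delta> n" for \<delta> n
  proof -
    define l where "l = g n \<circ> \<delta> \<circ> finv (g n)"
    have "l \<in> \<Lambda>" using st(5)[of n] st(1)[of n] \<delta> by (auto simp: l_def conj_by_eq)
    then have l: "l \<in> Homeo" by (rule S'(1))
    have comm: "g m (\<delta> x) = l (g m x)" if "m \<ge> n" for m x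
    proof -
      have "g m \<circ> \<delta> \<circ> finv (g m) = l" using ext[OF that] \<delta> by (simp add: extends_def l_def)
      then have "(g m \<circ> \<delta> \<circ> finv (g m)) (g m x) = l (g m x)" by simp
      then show ?thesis using st(1)[of m] by simp
    qed
    have lG: "l (G x) = G (\<delta> x)" for x
    proof (rule clopen_points_eq[OF X])
      fix U assume U: "clopen U" "l (G x) \<in> U"
      obtain N1 where N1: "\<And>m. m \<ge> N1 \<Longrightarrow> G -` U = g m -` U" using G(2)[OF U(1)] by blast
      obtain N2 where N2: "\<And>m. m \<ge> N2 \<Longrightarrow> G -` (l -` U) = g m -` (l -` U)"
        using G(2)[OF Homeo_clopen_vimage[OF l U(1)]] by blast
      let ?m = "max n (max N1 N2)"
      have le: "n \<le> ?m" "N1 \<le> ?m" "N2 \<le> ?m" by auto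
      have "x \<in> g ?m -` (l -` U)" unfolding N2[OF le(3), symmetric] using U(2) by simp
      then have "\<delta> x \<in> g ?m -` U" using comm[OF le(1), of x] by simp
      then show "G (\<delta> x) \<in> U" unfolding N1[OF le(2), symmetric] by simp
    qed
    have "G \<circ> \<delta> \<circ> finv G = l" using G(1) by (simp add: fun_eq_iff lG[symmetric])
    then show ?thesis by (simp add: l_def)
  qed
  have "conj_by G \<Gamma> = \<Lambda>"
  proof (rule Set.set_eqI, rule iffI)
    fix l assume "l \<in> conj_by G \<Gamma>"
    then obtain \<gamma> where \<gamma>: "\<gamma> \<in> \<Gamma>" "l = G \<circ> \<gamma> \<circ> finv G" using G(1) by (auto simp: conj_by_eq)
    obtain n where n: "\<gamma> \<in> \<Delta> n" using reach[OF \<gamma>(1) S'(2) clopen_basic(1)] by (elim exE conjE)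
    have "g n \<circ> \<gamma> \<circ> finv (g n) \<in> \<Lambda>" using st(5)[of n] st(1)[of n] n by (auto simp: conj_by_eq)
    then show "l \<in> \<Lambda>" using limit[OF n] \<gamma>(2) by simp
  next
    fix l assume l: "l \<in> \<Lambda>"
    obtain n where "l \<in> conj_by (g n) (\<Delta> n)" using reach[OF S(2) l clopen_basic(1)] by (elim exE conjE)
    then obtain \<delta> where \<delta>: "\<delta> \<in> \<Delta> n" "l = g n \<circ> \<delta> \<circ> finv (g n)" using st(1)[of n] by (auto simp: conj_by_eq)
    then have "l = G \<circ> \<delta> \<circ> finv G" using limit[OF \<delta>(1)] by simp
    then show "l \<in> conj_by G \<Gamma>" using st(4)[of n] \<delta>(1) G(1) by (auto simp: conj_by_eq)
  qed
  \<comment> \<open>At a late stage the preimage of \<open>U\<close> under \<open>g m\<close> agrees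
    with that under \<open>G\<close> and belongs to \<open>F m\<close>. It contains
    \<open>x\<close>, so by the atom condition it contains \<open>finv (g m) (h x)\<close>, which
    says that \<open>h x\<close> lies in \<open>U\<close>.\<close>
  moreover have "G x = h x" if x: "x \<in> K" for x
  proof (rule clopen_points_eq[OF X])
    fix U assume U: "clopen U" "G x \<in> U"
    obtain N1 where N1: "\<And>m. m \<ge> N1 \<Longrightarrow> G -` U = g m -` U" using G(2)[OF U(1)] by blast
    obtain N2 where N2: "\<And>m. m \<ge> N2 \<Longrightarrow> finv (g m) ` U \<in> F m" using preimages[OF U(1)] by blast
    let ?m = "max N1 N2"
    have le: "N1 \<le> ?m" "N2 \<le> ?m" by auto
    have "x \<in> g ?m -` U" unfolding N1[OF le(1), symmetric] using U(2) by simp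
    then have "g ?m x \<in> U" by simp
    then have "x \<in> finv (g ?m) ` U" using st(1)[of ?m] by (metis Homeo_inv_f imageI)
    moreover have "sig (F ?m) (finv (g ?m) (h x)) = sig (F ?m) x" by (rule st(7)[OF x])
    ultimately have "finv (g ?m) (h x) \<in> finv (g ?m) ` U" using N2[OF le(2)] by (simp add: sig_eq_iff)
    then show "h x \<in> U" using Homeo_inv[OF st(1)[of ?m]] by simp
  qed
  ultimately show ?thesis using G(1) by blast
qed

end
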